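(* Let $a,b,c$ be positive integers with $b\le a\le c$. Then $$L^*_*(H_{\mathrm d}(a,b,c))=2^{-a-b}\prod_{j=1}^{b}\frac{(j-1)!\,(a+c-b+2j-1)!\,(c-a+3j-1)_{b-j}\,(a+2c+3j-1)_{b-j+1}}{(b+c+j-1)!\,(a-b+2j-1)!}.$$
   Context: Shifted factorial: $(\alpha)_k=\alpha(\alpha+1)\cdots(\alpha+k-1)$ for $k\ge1$, and $(\alpha)_0=1$. Triangular lattice: let $e=(1,0)$, $f=(1/2,\sqrt3/2)$, $g=f-e=(-1/2,\sqrt3/2)$, and consider the lattice $\mathbb Z e+\mathbb Z f$ with its tiling of the plane by unit equilateral triangles. A lozenge is the union of two unit triangles sharing an edge. A lozenge tiling of a region $R$ (a finite union of unit triangles) is a decomposition of $R$ into lozenges with disjoint interiors. $H(a,b,c)$ ($a,b,c$ positive integers) is the hexagon with vertices, in counterclockwise order, $0$ (southwestern corner), $be$ (southeastern corner), $be+af$ (eastern corner), $be+af+cg$ (northeastern corner), $af+cg$ (northwestern corner), $cg$ (western corner). Thus its horizontal sides have length $b$, the southeastern and northwestern sides have length $a$, and the northeastern and southwestern sides have length $c$. Maximal staircase at a corner $V$: let $p,q$ be the lengths of the two sides meeting at $V$, let $s,t$ be the unit vectors pointing from $V$ along these two sides (they form an angle of $120^\circ$), and let $m=\min(p,q)$. For $i,j\ge1$ let the cell $(i,j)$ be the lozenge with vertices $V+(i-1)s+(j-1)t$, $V+is+(j-1)t$, $V+is+jt$, $V+(i-1)s+jt$. The maximal staircase at $V$ is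 the union of all cells $(i,j)$ with $i,j\ge1$ and $i+j\le m$. The marked positions along the cut at $V$ are the $m$ cells $(i,j)$ with $i,j\ge1$ and $i+j=m+1$ (the lozenge positions fitting in the indentations of the zig-zag cut that removed the staircase). $H_{\mathrm d}(a,b,c)$ is the region obtained from $H(a,b,c)$ by removing the maximal staircases at the northwestern corner (where sides of lengths $a$ and $b$ meet) and at the eastern corner (where sides of lengths $a$ and $c$ meet). $L^*_*(H_{\mathrm d}(a,b,c))=\sum_T 2^{-k(T)}$, where $T$ ranges over all lozenge tilings of $H_{\mathrm d}(a,b,c)$ and $k(T)$ is the number of lozenges of $T$ that occupy marked positions along the cut at the northwestern corner or along the cut at the eastern corner. *)

theory Defs
  imports "HOL-Analysis.Analysis" "HOL-Library.Disjoint_Sets" "HOL-Library.Product_Plus"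
begin

text \<open>A lattice point \<open>x e + y f\<close> is represented by its coordinate pair \<open>(x, y)\<close>, and a unit
  triangle by the set of its three vertices.\<close>

type_synonym lattice_point = "int \<times> int"
type_synonym triangle = "lattice_point set"

definition lattice_scale :: "int \<Rightarrow> lattice_point \<Rightarrow> lattice_point"  (infixr "*\<^sub>L" 75) where
  "k *\<^sub>L p = (k * fst p, k * snd p)"

definition vec_e :: lattice_point where "vec_e = (1, 0)"
definition vec_f :: lattice_point where "vec_f = (0, 1)"
definition vec_g :: lattice_point where "vec_g = vec_f - vec_e"

definition embed :: "lattice_point \<Rightarrow> complex" where
  "embed p = of_int (fst p) * Complex 1 0 + of_int (snd p) * Complex (1/2) (sqrt 3 / 2)"

definition unit_triangle :: "triangle \<Rightarrow> bool" where
  "unit_triangle t \<longleftrightarrow> (\<exists>p. t = {p, p + vec_e, p + vec_f} \<or> t = {p, p + vec_f, p + vec_g})"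

text \<open>A region is the set of the unit triangles it is made of; so a lozenge is a pair of unit
  triangles with exactly two common vertices, and a decomposition into lozenges with disjoint
  interiors is a set partition into lozenges.\<close>

definition lozenge :: "triangle set \<Rightarrow> bool" where
  "lozenge l \<longleftrightarrow> (\<exists>t u. unit_triangle t \<and> unit_triangle u \<and> card (t \<inter> u) = 2 \<and> l = {t, u})"

definition lozenge_tilings :: "triangle set \<Rightarrow> triangle set set set" where
  "lozenge_tilings R = {T. partition_on R T \<and> (\<forall>l\<in>T. lozenge l)}"

definition hexagon_vertices :: "nat \<Rightarrow> nat \<Rightarrow> nat \<Rightarrow> lattice_point set" where
  "hexagon_vertices a b c =
     {0,
      int b *\<^sub>L vec_e,
      int b *\<^sub>L vec_e + int a *\<^sub>L vec_f,
      int b *\<^sub>L vec_e + int a *\<^sub>L vec_f + int c *\<^sub>L vec_g,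
      int a *\<^sub>L vec_f + int c *\<^sub>L vec_g,
      int c *\<^sub>L vec_g}"

definition hexagon :: "nat \<Rightarrow> nat \<Rightarrow> nat \<Rightarrow> triangle set" where
  "hexagon a b c =
     {t. unit_triangle t \<and> embed ` t \<subseteq> convex hull (embed ` hexagon_vertices a b c)}"

text \<open>For unit lattice vectors \<open>s\<close>, \<open>t\<close> at an angle of 120 degrees, the short diagonal of the
  lozenge joins \<open>V + (i-1)s + (j-1)t\<close> to \<open>V + is + jt\<close>; it separates the two unit triangles.\<close>

definition cell ::
  "lattice_point \<Rightarrow> lattice_point \<Rightarrow> lattice_point \<Rightarrow> int \<Rightarrow> int \<Rightarrow> triangle set" where
  "cell V s t i j =
     {{V + (i - 1) *\<^sub>L s + (j - 1) *\<^sub>L t, V + i *\<^sub>L s + (j - 1) *\<^sub>L t, V + i *\<^sub>L s + j *\<^sub>L t},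
      {V + (i - 1) *\<^sub>L s + (j - 1) *\<^sub>L t, V + (i - 1) *\<^sub>L s + j *\<^sub>L t, V + i *\<^sub>L s + j *\<^sub>L t}}"

text \<open>Here \<open>m\<close> is the minimum of the lengths of the two sides meeting at \<open>V\<close>.\<close>

definition staircase ::
  "lattice_point \<Rightarrow> lattice_point \<Rightarrow> lattice_point \<Rightarrow> nat \<Rightarrow> triangle set" where
  "staircase V s t m = \<Union>{cell V s t i j | i j. 1 \<le> i \<and> 1 \<le> j \<and> i + j \<le> int m}"

definition marked ::
  "lattice_point \<Rightarrow> lattice_point \<Rightarrow> lattice_point \<Rightarrow> nat \<Rightarrow> triangle set set" where
  "marked V s t m = {cell V s t i j | i j. 1 \<le> i \<and> 1 \<le> j \<and> i + j = int m + 1}"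

definition nw_corner :: "nat \<Rightarrow> nat \<Rightarrow> nat \<Rightarrow> lattice_point" where
  "nw_corner a b c = int a *\<^sub>L vec_f + int c *\<^sub>L vec_g"

definition e_corner :: "nat \<Rightarrow> nat \<Rightarrow> nat \<Rightarrow> lattice_point" where
  "e_corner a b c = int b *\<^sub>L vec_e + int a *\<^sub>L vec_f"

text \<open>The sides at the northwestern corner leave it in directions \<open>e\<close> (length \<open>b\<close>) and \<open>-f\<close>
  (length \<open>a\<close>), those at the eastern corner in directions \<open>-f\<close> (length \<open>a\<close>) and \<open>g\<close>
  (length \<open>c\<close>).\<close>

definition dented_hexagon :: "nat \<Rightarrow> nat \<Rightarrow> nat \<Rightarrow> triangle set" where
  "dented_hexagon a b c =
     hexagon a b c
       - staircase (nw_corner a b c) vec_e (- vec_f) (min a b)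
       - staircase (e_corner a b c) (- vec_f) vec_g (min a c)"

definition marked_positions :: "nat \<Rightarrow> nat \<Rightarrow> nat \<Rightarrow> triangle set set" where
  "marked_positions a b c =
     marked (nw_corner a b c) vec_e (- vec_f) (min a b)
       \<union> marked (e_corner a b c) (- vec_f) vec_g (min a c)"

definition weighted_tiling_count :: "nat \<Rightarrow> nat \<Rightarrow> nat \<Rightarrow> real" where
  "weighted_tiling_count a b c =
     (\<Sum>T\<in>lozenge_tilings (dented_hexagon a b c). (1/2) ^ card (T \<inter> marked_positions a b c))"

subsection \<open>Inequalities describing the hexagon\<close>

lemma convex_hull_hexagon:
  assumes "a > 0" "b > 0" "c > 0"
  shows "embed (x, y) \<in> convex hull (embed ` hexagon_vertices a b c) \<longleftrightarrow>
    0 \<le> y \<and> y \<le> int a + int c \<and> - int c \<le> x \<and> x \<le> int b \<and> 0 \<le> x + y \<and> x + y \<le> int a + int b"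
    (is "_ \<in> ?H \<longleftrightarrow> ?ineq")
proof
  define E :: "real \<Rightarrow> real \<Rightarrow> complex" where "E u v = Complex (u + v/2) (v * sqrt 3 / 2)" for u v
  have embed_E: "embed (u, v) = E u v" for u v
    by (simp add: embed_def E_def complex_eq_iff)
  have H: "?H = convex hull {E 0 0, E b 0, E b a, E (real b - c) (real a + c),
      E (- real c) (real a + c), E (- real c) c}"
    by (simp add: hexagon_vertices_def lattice_scale_def vec_e_def vec_f_def vec_g_def embed_E
        zero_prod_def)
  define X Y where "X z = Re z - Im z / sqrt 3" and "Y z = 2 * Im z / sqrt 3" for z
  have XE: "X (E u v) = u" and YE: "Y (E u v) = v" for u v
    by (simp_all add: X_def Y_def E_def)
  define K where "K = {z. 0 \<le> Y z \<and> Y z \<le> real a + c \<and> - real c \<le> X z \<and> X z \<le> b \<and>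
      0 \<le> X z + Y z \<and> X z + Y z \<le> real a + b}"
  have lin: "linear X" "linear Y"
    unfolding X_def Y_def by (auto intro!: linearI simp: field_simps)
  have half: "convex {z. h z \<le> r}" "convex {z. r \<le> h z}" if "linear h"
    for h :: "complex \<Rightarrow> real" and r
    using convex_linear_vimage[OF that, of "{..r}"] convex_linear_vimage[OF that, of "{r..}"]
    by (simp_all add: vimage_def)
  have lXY: "linear (\<lambda>z. X z + Y z)" using lin by (rule linear_compose_add)
  have "K = {z. 0 \<le> Y z} \<inter> {z. Y z \<le> real a + c} \<inter> {z. - real c \<le> X z} \<inter> {z. X z \<le> b} \<inter>
      {z. 0 \<le> X z + Y z} \<inter> {z. X z + Y z \<le> real a + b}"
    by (auto simp: K_def)
  then have "convex K"
    by (simp add: convex_Int half[OF lin(1)] half[OF lin(2)] half[OF lXY])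
  then have sub: "?H \<subseteq> K"
    unfolding H by (intro hull_minimal) (auto simp: K_def XE YE)
  show ?ineq if "embed (x, y) \<in> ?H"
  proof -
    have "E x y \<in> K" using that sub embed_E by auto
    then have "0 \<le> real_of_int y \<and> real_of_int y \<le> real a + c \<and> - real c \<le> real_of_int x \<and>
        real_of_int x \<le> b \<and> 0 \<le> real_of_int x + y \<and> real_of_int x + y \<le> real a + b"
      by (simp add: K_def XE YE)
    then show ?thesis by linarith
  qed
  show "embed (x, y) \<in> ?H" if ineq: ?ineq
  proof -
    have cvx: "convex ?H" by (rule convex_convex_hull)
    have comb: "E ((1 - r) * u + r * u') ((1 - r) * v + r * v') \<in> ?H"
      if "E u v \<in> ?H" "E u' v' \<in> ?H" "0 \<le> r" "r \<le> 1" for u v u' v' r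
    proof -
      have "E ((1 - r) * u + r * u') ((1 - r) * v + r * v') = (1-r) *\<^sub>R E u v + r *\<^sub>R E u' v'"
        by (simp add: E_def complex_eq_iff field_simps)
      then show ?thesis using convexD[OF cvx that(1,2), of "1-r" r] that(3,4) by simp
    qed
    have vert: "E 0 0 \<in> ?H" "E b 0 \<in> ?H" "E b a \<in> ?H" "E (real b - c) (real a + c) \<in> ?H"
      "E (- real c) (real a + c) \<in> ?H" "E (- real c) c \<in> ?H"
      unfolding H by (auto intro: hull_inc)
    have pos: "real a > 0" "real b > 0" "real c > 0" using assms by auto
    define l where "l = max (- real c) (- real_of_int y)"
    define r where "r = min (real b) (real a + b - y)"
    have left: "E l y \<in> ?H"
    proof (cases "y \<le> int c")
      case True
      then have "real_of_int y \<le> c" by linarith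
      then show ?thesis
        using comb[OF vert(1) vert(6), of "y / c"] ineq pos by (simp add: l_def max_def split: if_splits)
    next
      case False
      then have "real_of_int y > c" by linarith
      moreover have "real_of_int y \<le> real a + c" using ineq by linarith
      moreover have "(1 - (y - real c) / a) * c + (y - real c) / a * (real a + c) = y"
        "(1 - (y - real c) / a) * (- real c) + (y - real c) / a * (- real c) = - real c"
        using pos by (simp_all add: field_simps)
      ultimately show ?thesis
        using comb[OF vert(6) vert(5), of "(y - real c) / a"] pos by (simp add: l_def max_def)
    qed
    have right: "E r y \<in> ?H"
    proof (cases "y \<le> int a")
      case True
      then have "real_of_int y \<le> a" by linarith
      moreover have "(1 - y / a) * b + y / a * b = b" using pos by (simp add: field_simps)
      ultimately show ?thesis
        using comb[OF vert(2) vert(3), of "y / a"] ineq pos by (simp add: r_def min_def)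
    next
      case False
      then have "real_of_int y > a" by linarith
      moreover have "real_of_int y \<le> real a + c" using ineq by linarith
      moreover have "(1 - (y - real a) / c) * a + (y - real a) / c * (real a + c) = y"
        "(1 - (y - real a) / c) * b + (y - real a) / c * (real b - c) = real a + b - y"
        using pos by (simp_all add: field_simps)
      ultimately show ?thesis
        using comb[OF vert(3) vert(4), of "(y - real a) / c"] pos by (simp add: r_def min_def)
    qed
    have "real_of_int x \<le> b" "real_of_int x + y \<le> real a + b" "- real c \<le> x" "0 \<le> real_of_int x + y"
      using ineq by linarith+
    then have lr: "l \<le> x" "x \<le> r" by (auto simp: l_def r_def)
    show ?thesis
    proof (cases "l = r")
      case True
      then show ?thesis using lr left embed_E by simp
    next
      case False
      define q where "q = (x - l) / (r - l)"
      have "q * (r - l) = x - l" using False by (simp add: q_def)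
      then have "(1 - q) * l + q * r = x" by (simp add: algebra_simps)
      moreover have "(1 - q) * y + q * y = y" by (simp add: algebra_simps)
      moreover have "0 \<le> q" "q \<le> 1" using lr False by (auto simp: q_def field_simps)
      ultimately show ?thesis using comb[OF left right, of q] embed_E by simp
    qed
  qed
qed

lemma finite_hexagon:
  assumes "a > 0" "b > 0" "c > 0"
  shows "finite (hexagon a b c)"
proof (rule finite_subset)
  show "hexagon a b c \<subseteq> Pow ({- int c..int b} \<times> {0..int a + int c})"
  proof
    fix t assume t: "t \<in> hexagon a b c"
    show "t \<in> Pow ({- int c..int b} \<times> {0..int a + int c})"
    proof (rule PowI, rule subsetI)
      fix p assume "p \<in> t"
      then have "embed (fst p, snd p) \<in> convex hull (embed ` hexagon_vertices a b c)"
        using t by (auto simp: hexagon_def)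
      then show "p \<in> {- int c..int b} \<times> {0..int a + int c}"
        unfolding convex_hull_hexagon[OF assms] by (cases p) auto
    qed
  qed
qed simp

lemma finite_lozenge_tilings:
  assumes "finite R"
  shows "finite (lozenge_tilings R)"
proof (rule finite_subset)
  show "lozenge_tilings R \<subseteq> Pow (Pow R)"
    by (auto simp: lozenge_tilings_def partition_on_def)
qed (use assms in simp)

end

theory Submission
  imports Defs "Jordan_Normal_Form.Determinant"
begin

text \<open>
  Call a horizontal unit edge open if it is not the short diagonal of a lozenge. Following the
  lozenges that contain horizontal edges upwards, every tiling of the dented hexagon becomes a family
  of \<open>b\<close> nonintersecting paths of open edges: they start on the bottom side, move one row up by
  \<open>f\<close> or by \<open>g\<close> at each step, and end on the \<open>b\<close> horizontal edges of the zig-zag at the northwestern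
  corner.

  Both halving rules are local for these paths. A marked lozenge at the northwestern cut is a last
  step in direction \<open>f\<close>. A marked lozenge at the eastern cut is an edge on the wall
  \<open>2 x + y = 2 b - 1\<close> that no path visits; there are \<open>a\<close> such edges, so the eastern weight is
  \<open>2\<^sup>-\<^sup>a\<close> times a factor 2 for every visit of the wall. In the coordinate \<open>2 x + y\<close> the paths
  are simple random walks below a reflecting wall, and the factor 2 per visit is exactly what
  folding free walks at the wall produces. Hence the weight of all paths between two points is a sum of
  two free terms, one from the starting point and one from its mirror image
  (\<open>path_weight_step\<close>).

  The passage from paths to a determinant is a sweep over the region, one triangle after the other
  and row by row. During the sweep the weighted number of tilings of the remaining region equals the
  determinant of the path weights from the current path positions: deciding the lozenge of one triangle is
  the linear expansion of one row, and the forbidden case, in which two paths meet, gives two equal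
  rows (\<open>sweep_occupied\<close>, \<open>tiling_sum_det\<close>).

  The determinant is evaluated in two steps. Since the rows are mirror sums, a unitriangular combination of them
  with the coefficients \<open>2 m + 1\<close> choose \<open>m - j\<close> collapses row \<open>m\<close> to a single free
  walk with \<open>2 m + 1\<close> more steps, that is, to a ratio of factorials times \<open>(a + 2 c + 3 m + 2) / 2\<close>, a factor
  that does not depend on the column (\<open>det_reflected_walks\<close>). The remaining matrix has the entries
  \<open>(X + Y - 1 + 2 m - l)! / ((X + m - 2 l)! (Y + m + l)!)\<close>; deleting a first row or a first column
  only changes \<open>X\<close> and \<open>Y\<close>. So Dodgson condensation is a recurrence inside this family, and the
  product formula is verified by induction (\<open>det_shifted_entry\<close>).
\<close>

section \<open>Determinants and Dodgson condensation\<close>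

text \<open>Entries are given by a function of the indices, so that passing to a minor is a shift of the
  arguments.\<close>

definition det_of :: "nat \<Rightarrow> (nat \<Rightarrow> nat \<Rightarrow> real) \<Rightarrow> real" where
  "det_of n f = Determinant.det (Matrix.mat n n (\<lambda>(i, j). f i j))"

lemma det_of_cong:
  assumes "\<And>i j. i < n \<Longrightarrow> j < n \<Longrightarrow> f i j = g i j"
  shows "det_of n f = det_of n g"
  unfolding det_of_def using assms by (intro arg_cong[of _ _ Determinant.det] eq_matI) auto

definition cof :: "nat \<Rightarrow> (nat \<Rightarrow> nat \<Rightarrow> real) \<Rightarrow> nat \<Rightarrow> nat \<Rightarrow> real" where
  "cof n f k l = (- 1) ^ (k + l) *
     det_of (n - 1) (\<lambda>i j. f (if i < k then i else Suc i) (if j < l then j else Suc j))"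

lemma cofactor_mat:
  assumes "k < n" "l < n"
  shows "cofactor (Matrix.mat n n (\<lambda>(i, j). f i j)) k l = cof n f k l"
  unfolding cofactor_def cof_def det_of_def mat_delete_def
  by (rule arg_cong[of _ _ "\<lambda>x. _ * Determinant.det x"], rule eq_matI) (use assms in auto)

lemma row_times_cof:
  assumes "i < n" "k < n"
  shows "(\<Sum>j<n. f i j * cof n f k j) = (if i = k then det_of n f else 0)"
proof -
  let ?A = "Matrix.mat n n (\<lambda>(i, j). f i j)"
  have "(?A * adj_mat ?A) $$ (i, k) = (Determinant.det ?A \<cdot>\<^sub>m 1\<^sub>m n) $$ (i, k)"
    by (subst adj_mat(2)[of _ n]) auto
  moreover have "(?A * adj_mat ?A) $$ (i, k) = (\<Sum>j<n. f i j * cof n f k j)"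
    using assms by (auto simp: times_mat_def scalar_prod_def adj_mat_def cofactor_mat lessThan_atLeast0
        intro!: sum.cong)
  ultimately show ?thesis using assms by (auto simp: det_of_def)
qed

lemma cof_times_col:
  assumes "j < n" "l < n"
  shows "(\<Sum>i<n. cof n f i l * f i j) = (if j = l then det_of n f else 0)"
proof -
  let ?A = "Matrix.mat n n (\<lambda>(i, j). f i j)"
  have "(adj_mat ?A * ?A) $$ (l, j) = (Determinant.det ?A \<cdot>\<^sub>m 1\<^sub>m n) $$ (l, j)"
    by (subst adj_mat(3)[of _ n]) auto
  moreover have "(adj_mat ?A * ?A) $$ (l, j) = (\<Sum>i<n. cof n f i l * f i j)"
    using assms by (auto simp: times_mat_def scalar_prod_def adj_mat_def cofactor_mat lessThan_atLeast0
        intro!: sum.cong)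
  ultimately show ?thesis using assms by (auto simp: det_of_def)
qed

lemma det_of_0 [simp]: "det_of 0 f = 1"
  unfolding det_of_def by (rule det_dim_zero) auto

lemma det_of_Suc_0: "det_of (Suc 0) f = f 0 0"
  unfolding det_of_def by (subst det_single) auto

lemma det_of_zero_col:
  assumes "l < n" "\<And>i. i < n \<Longrightarrow> f i l = 0"
  shows "det_of n f = 0"
  using cof_times_col[OF assms(1,1), of f] assms(2) by simp

lemma det_of_equal_rows:
  assumes "i < n" "k < n" "i \<noteq> k" "\<And>j. j < n \<Longrightarrow> f i j = f k j"
  shows "det_of n f = 0"
proof -
  have "det_of n f = (\<Sum>j<n. f k j * cof n f k j)" using row_times_cof[of k n k f] assms by simp
  also have "\<dots> = (\<Sum>j<n. f i j * cof n f k j)" using assms by (intro sum.cong) auto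
  also have "\<dots> = 0" using row_times_cof[of i n k f] assms by simp
  finally show ?thesis .
qed

text \<open>The cofactors along row \<open>k\<close> do not involve row \<open>k\<close>, so the Laplace expansion
  along this row is linear in it.\<close>

lemma det_of_row_linear:
  assumes "k < n"
  shows "det_of n (f(k := \<lambda>j. \<alpha> * u j + \<beta> * v j)) = \<alpha> * det_of n (f(k := u)) + \<beta> * det_of n (f(k := v))"
proof -
  have cof: "cof n (f(k := w)) k j = cof n f k j" for w j
    unfolding cof_def by (rule arg_cong[of _ _ "\<lambda>x. _ * x"], rule det_of_cong) auto
  have exp: "det_of n (f(k := w)) = (\<Sum>j<n. w j * cof n f k j)" for w
    using row_times_cof[OF assms assms, of "f(k := w)"] by (simp add: cof)
  show ?thesis
    unfolding exp by (simp add: sum_distrib_left sum.distrib algebra_simps)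
qed

lemma det_of_scale_rows:
  "det_of n (\<lambda>i j. r i * f i j) = (\<Prod>i<n. r i) * det_of n f"
proof -
  have "det_of n (\<lambda>i j. r i * f i j) = Determinant.det (mat\<^sub>r n n (\<lambda>i. r i \<cdot>\<^sub>v Matrix.vec n (f i)))"
    unfolding det_of_def by (intro arg_cong[of _ _ Determinant.det] eq_matI) auto
  also have "\<dots> = prod r {0..<n} * Determinant.det (mat\<^sub>r n n (\<lambda>i. Matrix.vec n (f i)))"
    by (rule det_rows_mul) auto
  also have "Determinant.det (mat\<^sub>r n n (\<lambda>i. Matrix.vec n (f i))) = det_of n f"
    unfolding det_of_def by (intro arg_cong[of _ _ Determinant.det] eq_matI) auto
  finally show ?thesis by (simp add: lessThan_atLeast0)
qed

lemma det_of_unitriangular: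
  assumes "\<And>i j. i < n \<Longrightarrow> j < n \<Longrightarrow> i < j \<Longrightarrow> f i j = 0" "\<And>i. i < n \<Longrightarrow> f i i = 1"
  shows "det_of n f = 1"
proof -
  have "det_of n f = prod_list (diag_mat (Matrix.mat n n (\<lambda>(i, j). f i j)))"
    unfolding det_of_def by (rule det_lower_triangular[of n]) (use assms in auto)
  also have "\<dots> = 1"
    by (subst prod_list_diag_prod) (use assms in auto)
  finally show ?thesis .
qed

lemma det_of_mult:
  "det_of n (\<lambda>i j. \<Sum>k<n. f i k * g k j) = det_of n f * det_of n g"
proof -
  let ?F = "Matrix.mat n n (\<lambda>(i, j). f i j)" and ?G = "Matrix.mat n n (\<lambda>(i, j). g i j)"
  have "Matrix.mat n n (\<lambda>(i, j). \<Sum>k<n. f i k * g k j) = ?F * ?G"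
    by (rule eq_matI) (auto simp: times_mat_def scalar_prod_def lessThan_atLeast0 intro!: sum.cong)
  then show ?thesis unfolding det_of_def using det_mult[of ?F n ?G] by simp
qed

text \<open>The Desnanot--Jacobi identity. The vectors of cofactors along the first and along the last row are
  mapped by the matrix to multiples of unit vectors. Their combination \<open>w\<close> with vanishing last
  coordinate lives on the leading minor, and Cramer's rule there determines the first coordinate of
  \<open>w\<close>, which is the right-hand side of the identity.\<close>

lemma det_of_condensation:
  assumes nz: "det_of (Suc n) f \<noteq> 0"
  shows "det_of (Suc (Suc n)) f * det_of n (\<lambda>i j. f (Suc i) (Suc j)) =
    det_of (Suc n) f * det_of (Suc n) (\<lambda>i j. f (Suc i) (Suc j))
      - det_of (Suc n) (\<lambda>i j. f (Suc i) j) * det_of (Suc n) (\<lambda>i j. f i (Suc j))"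
proof -
  let ?N = "Suc (Suc n)" and ?l = "Suc n"
  define d where "d = det_of ?N f"
  define C where "C = cof ?N f"
  \<comment> \<open>The last coordinate of \<open>w\<close> is zero.\<close>
  define w where "w j = C ?l ?l * C 0 j - C 0 ?l * C ?l j" for j
  have corner: "C ?l ?l = det_of ?l f"
    unfolding C_def cof_def by (auto intro!: det_of_cong)
  have c00: "C 0 0 = det_of ?l (\<lambda>i j. f (Suc i) (Suc j))"
    unfolding C_def cof_def by (auto intro!: det_of_cong)
  have c0l: "C 0 ?l = (- 1) ^ ?l * det_of ?l (\<lambda>i j. f (Suc i) j)"
    unfolding C_def cof_def by (auto intro!: det_of_cong)
  have cl0: "C ?l 0 = (- 1) ^ ?l * det_of ?l (\<lambda>i j. f i (Suc j))"
    unfolding C_def cof_def by (auto intro!: det_of_cong)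
  have inner: "cof ?l f 0 0 = det_of n (\<lambda>i j. f (Suc i) (Suc j))"
    unfolding cof_def by (auto intro!: det_of_cong)
  have fw: "(\<Sum>j<?l. f i j * w j) = (if i = 0 then C ?l ?l * d else 0)" if "i < ?l" for i
  proof -
    have "(\<Sum>j<?l. f i j * w j) = (\<Sum>j<?N. f i j * w j)" by (simp add: w_def)
    also have "\<dots> = C ?l ?l * (\<Sum>j<?N. f i j * C 0 j) - C 0 ?l * (\<Sum>j<?N. f i j * C ?l j)"
      unfolding w_def by (simp add: sum_distrib_left sum_subtractf algebra_simps)
    also have "\<dots> = C ?l ?l * (if i = 0 then d else 0)"
      using row_times_cof[of i ?N 0 f] row_times_cof[of i ?N ?l f] that by (simp add: C_def d_def)
    finally show ?thesis by simp
  qed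
  have "det_of ?l f * w 0 = (\<Sum>j<?l. (\<Sum>i<?l. cof ?l f i 0 * f i j) * w j)"
    by (simp add: cof_times_col if_distrib[of "\<lambda>x. x * _"] sum.delta cong: if_cong del: sum.lessThan_Suc)
  also have "\<dots> = (\<Sum>i<?l. \<Sum>j<?l. cof ?l f i 0 * f i j * w j)"
    unfolding sum_distrib_right by (rule sum.swap)
  also have "\<dots> = (\<Sum>i<?l. cof ?l f i 0 * (\<Sum>j<?l. f i j * w j))"
    by (simp add: sum_distrib_left mult.assoc del: sum.lessThan_Suc)
  also have "\<dots> = (\<Sum>i<?l. if i = 0 then cof ?l f 0 0 * C ?l ?l * d else 0)"
    by (intro sum.cong refl) (simp add: fw del: sum.lessThan_Suc)
  also have "\<dots> = cof ?l f 0 0 * C ?l ?l * d"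
    by (simp add: sum.delta del: sum.lessThan_Suc)
  finally have "w 0 = cof ?l f 0 0 * d" using nz by (simp add: corner)
  moreover have "w 0 = det_of ?l f * det_of ?l (\<lambda>i j. f (Suc i) (Suc j))
      - det_of ?l (\<lambda>i j. f (Suc i) j) * det_of ?l (\<lambda>i j. f i (Suc j))"
    unfolding w_def corner c00 c0l cl0 by (simp flip: power_mult_distrib add: algebra_simps)
  ultimately show ?thesis by (simp add: inner d_def mult.commute)
qed

section \<open>A two-parameter family of determinants\<close>

text \<open>Factorials of integers, with the convention \<open>1 / z! = 0\<close> for negative \<open>z\<close>.
  This makes the recurrence of the reciprocal factorial valid for all integers, so that vanishing entries
  and vanishing determinants need no separate treatment.\<close>

definition zfact :: "int \<Rightarrow> real" where
  "zfact z = fact (nat z)"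

definition inv_fact :: "int \<Rightarrow> real" where
  "inv_fact z = (if z < 0 then 0 else 1 / fact (nat z))"

lemma zfact_rec: "0 \<le> z \<Longrightarrow> zfact (z + 1) = of_int (z + 1) * zfact z"
  by (simp add: zfact_def nat_add_distrib)

lemma zfact_pred: "1 \<le> z \<Longrightarrow> zfact z = of_int z * zfact (z - 1)"
  using zfact_rec[of "z - 1"] by simp

lemma inv_fact_rec: "of_int z * inv_fact z = inv_fact (z - 1)"
proof (cases "z \<le> 0")
  case False
  then obtain n where "z = int (Suc n)" by (metis not_le zero_less_imp_eq_int gr0_implies_Suc)
  then show ?thesis by (simp add: inv_fact_def nat_add_distrib)
qed (auto simp: inv_fact_def)

lemma zfact_nz [simp]: "zfact z \<noteq> 0" by (simp add: zfact_def)
lemma inv_fact_nz: "0 \<le> z \<Longrightarrow> inv_fact z \<noteq> 0" by (simp add: inv_fact_def)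

definition superfact :: "nat \<Rightarrow> real" where
  "superfact n = (\<Prod>j<n. fact j)"

text \<open>The factors of the product formula, each parametrised so that the three shifts of condensation become
  shifts of its integer argument.\<close>

definition step2_prod :: "(int \<Rightarrow> real) \<Rightarrow> nat \<Rightarrow> int \<Rightarrow> real" where
  "step2_prod \<phi> n s = (\<Prod>j<n. \<phi> (s - int n + 2 * int j))"

definition run_prod :: "nat \<Rightarrow> int \<Rightarrow> real" where
  "run_prod n Y = (\<Prod>j<n. inv_fact (Y + int n + int j - 1))"

definition poch_prod :: "nat \<Rightarrow> int \<Rightarrow> real" where
  "poch_prod n t = (\<Prod>j<n. pochhammer (of_int (t + 3 * int j + 1)) (n - 1 - j))"

lemma superfact_rel:
  "superfact (Suc (Suc n)) * superfact n = real (Suc n) * (superfact (Suc n))\<^sup>2"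
  by (simp add: superfact_def power2_eq_square algebra_simps)

lemma step2_prod_bottom:
  "step2_prod \<phi> (Suc n) s = \<phi> (s - int n - 1) * step2_prod \<phi> n (s + 1)"
  unfolding step2_prod_def
  by (subst prod.lessThan_Suc_shift) (simp add: algebra_simps)

lemma step2_prod_top:
  "step2_prod \<phi> (Suc n) s = step2_prod \<phi> n (s - 1) * \<phi> (s + int n - 1)"
  unfolding step2_prod_def by (simp add: algebra_simps)

lemma run_prod_Suc:
  "run_prod (Suc n) Y = run_prod n (Y + 1) * inv_fact (Y + 2 * int n)"
  unfolding run_prod_def by (simp add: algebra_simps)

lemma run_prod_shift:
  "run_prod (Suc n) Y = inv_fact (Y + int n) * run_prod n (Y + 2)"
  unfolding run_prod_def
  by (subst prod.lessThan_Suc_shift) (simp add: algebra_simps)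

lemma poch_prod_Suc:
  "poch_prod (Suc n) t = poch_prod n t * (\<Prod>j<n. of_int (t + int n + 2 * int j))"
proof -
  have "poch_prod (Suc n) t = (\<Prod>j<n. pochhammer (of_int (t + 3 * int j + 1)) (n - j))"
    unfolding poch_prod_def by simp
  also have "\<dots> = (\<Prod>j<n. pochhammer (of_int (t + 3 * int j + 1)) (n - 1 - j) * of_int (t + int n + 2 * int j))"
  proof (intro prod.cong refl)
    fix j assume "j \<in> {..<n}"
    then obtain m where "n = Suc (j + m)" by (auto dest: less_imp_Suc_add)
    then show "pochhammer (of_int (t + 3 * int j + 1)) (n - j) =
      pochhammer (of_int (t + 3 * int j + 1)) (n - 1 - j) * (of_int (t + int n + 2 * int j) :: real)"
      by (simp add: pochhammer_Suc algebra_simps)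
  qed
  finally show ?thesis by (simp add: prod.distrib poch_prod_def)
qed

text \<open>Passing from \<open>n\<close> to \<open>n + 1\<close> multiplies the product by an arithmetic
  progression. The progressions belonging to the two sides differ only in their first member, which is the
  factor in front.\<close>

lemma poch_prod_rel:
  "poch_prod (Suc (Suc n)) t * poch_prod n (t + 3) =
    of_int (t + int n + 1) * (poch_prod (Suc n) t * poch_prod (Suc n) (t + 3))"
proof -
  have "(\<Prod>j<Suc n. of_int (t + int (Suc n) + 2 * int j) :: real) =
      of_int (t + int n + 1) * (\<Prod>j<n. of_int (t + 3 + int n + 2 * int j))"
    by (subst prod.lessThan_Suc_shift) (simp add: algebra_simps)
  then show ?thesis
    unfolding poch_prod_Suc[of "Suc n" t] poch_prod_Suc[of n "t + 3"] by (simp add: mult_ac)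
qed

definition shifted_det_value :: "nat \<Rightarrow> int \<Rightarrow> int \<Rightarrow> real" where
  "shifted_det_value n X Y =
     superfact n * step2_prod zfact n (X + Y) * step2_prod inv_fact n (X + 1) * run_prod n Y
       * (poch_prod n (Y - X) * poch_prod n (X + 2 * Y))"

text \<open>In these determinants \<open>m\<close> is the row and \<open>l\<close> the column. Raising
  \<open>m\<close> by one is the same as raising \<open>X\<close> and \<open>Y\<close> by one; raising
  \<open>l\<close> by one is the same as replacing \<open>(X, Y)\<close> by \<open>(X - 2, Y + 1)\<close>.\<close>

definition shifted_entry :: "int \<Rightarrow> int \<Rightarrow> nat \<Rightarrow> nat \<Rightarrow> real" where
  "shifted_entry X Y m l =
     zfact (X + Y - 1 + 2 * int m - int l) * inv_fact (X + int m - 2 * int l) * inv_fact (Y + int m + int l)"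

text \<open>The product formula satisfies the condensation recurrence. Each of the three products equals a common
  factor \<open>Z\<close> times a cubic polynomial, since in every factor of the formula the factorials
  telescope; what is left is an identity between the three cubics.\<close>

lemma shifted_det_value_condensation:
  assumes "int n + 1 \<le> X" "X < Y"
  shows "shifted_det_value (Suc (Suc n)) X Y * shifted_det_value n (X - 1) (Y + 2) =
    shifted_det_value (Suc n) X Y * shifted_det_value (Suc n) (X - 1) (Y + 2)
      - shifted_det_value (Suc n) (X + 1) (Y + 1) * shifted_det_value (Suc n) (X - 2) (Y + 1)"
proof -
  let ?G = "step2_prod zfact" and ?U = "step2_prod inv_fact"
  define s where "s = X + Y"
  define g where "g = ?G (Suc (Suc n)) s * ?G n (s + 1)"
  define u where "u = ?U (Suc (Suc n)) (X + 1) * ?U n X"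
  define v where "v = run_prod (Suc (Suc n)) Y * run_prod n (Y + 2)"
  define q where "q t = poch_prod (Suc n) t * poch_prod (Suc n) (t + 3)" for t
  define S where "S = (superfact (Suc n))\<^sup>2"
  define Z where "Z = S * g * u * v * (q (Y - X) * q (X + 2 * Y))"
  have shift: "X + Y = s" "X - 1 + (Y + 2) = s + 1" "X + 1 + (Y + 1) = s + 2" "X - 2 + (Y + 1) = s - 1"
    "X - 1 + 1 = X" "X + 1 + 1 = X + 2" "X - 2 + 1 = X - 1"
    "Y + 2 - (X - 1) = Y - X + 3" "Y + 1 - (X + 1) = Y - X" "Y + 1 - (X - 2) = Y - X + 3"
    "X - 1 + 2 * (Y + 2) = X + 2 * Y + 3" "X + 1 + 2 * (Y + 1) = X + 2 * Y + 3"
    "X - 2 + 2 * (Y + 1) = X + 2 * Y"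
    by (simp_all add: s_def)
  have s: "int n + 2 \<le> s" using assms by (simp add: s_def)
  have g1: "?G (Suc n) s * ?G (Suc n) (s + 1) = of_int (s - int n - 1) * g"
    using step2_prod_bottom[of zfact "Suc n" s] step2_prod_bottom[of zfact n s]
      zfact_pred[of "s - int n - 1"] s
    unfolding g_def by (simp add: diff_diff_eq)
  have g2: "?G (Suc n) (s + 2) * ?G (Suc n) (s - 1) = of_int (s + int n + 1) * g"
    using step2_prod_top[of zfact "Suc n" s] step2_prod_top[of zfact n "s + 2"]
      zfact_pred[of "s + int n + 1"] s
    unfolding g_def by (simp add: algebra_simps)
  have u1: "?U (Suc n) (X + 1) * ?U (Suc n) X = of_int (X + int n + 1) * u"
    using step2_prod_top[of inv_fact "Suc n" "X + 1"] step2_prod_top[of inv_fact n "X + 1"]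
      inv_fact_rec[of "X + int n + 1"]
    unfolding u_def by (simp add: add_ac)
  have u2: "?U (Suc n) (X + 2) * ?U (Suc n) (X - 1) = of_int (X - int n - 1) * u"
  proof -
    have "?U (Suc (Suc n)) (X + 1) = inv_fact (X - int n - 1) * ?U (Suc n) (X + 2)"
      using step2_prod_bottom[of inv_fact "Suc n" "X + 1"] by (simp add: algebra_simps)
    moreover have "?U (Suc n) (X - 1) = inv_fact (X - int n - 2) * ?U n X"
      using step2_prod_bottom[of inv_fact n "X - 1"] by (simp add: algebra_simps)
    moreover have "inv_fact (X - int n - 2) = of_int (X - int n - 1) * inv_fact (X - int n - 1)"
      using inv_fact_rec[of "X - int n - 1"] by simp
    ultimately show ?thesis unfolding u_def by simp
  qed
  have v1: "run_prod (Suc n) Y * run_prod (Suc n) (Y + 2) = of_int (Y + int n + 1) * v"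
    using run_prod_shift[of "Suc n" Y] run_prod_shift[of n Y] inv_fact_rec[of "Y + int n + 1"]
    unfolding v_def by (simp add: add_ac)
  have v2: "run_prod (Suc n) (Y + 1) * run_prod (Suc n) (Y + 1) = of_int (Y + 2 * int n + 2) * v"
    using run_prod_Suc[of "Suc n" Y] run_prod_Suc[of n "Y + 1"] inv_fact_rec[of "Y + 2 * int n + 2"]
    unfolding v_def by (simp add: add_ac)
  have "shifted_det_value (Suc n) X Y * shifted_det_value (Suc n) (X - 1) (Y + 2) =
      S * (?G (Suc n) s * ?G (Suc n) (s + 1)) * (?U (Suc n) (X + 1) * ?U (Suc n) X)
        * (run_prod (Suc n) Y * run_prod (Suc n) (Y + 2)) * (q (Y - X) * q (X + 2 * Y))"
    unfolding shifted_det_value_def S_def q_def shift power2_eq_square by (simp only: mult_ac)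
  also have "\<dots> = of_int ((s - int n - 1) * (X + int n + 1) * (Y + int n + 1)) * Z"
    unfolding g1 u1 v1 Z_def of_int_mult by (simp only: mult_ac)
  finally have p11: "shifted_det_value (Suc n) X Y * shifted_det_value (Suc n) (X - 1) (Y + 2) =
      of_int ((s - int n - 1) * (X + int n + 1) * (Y + int n + 1)) * Z" .
  have "shifted_det_value (Suc n) (X + 1) (Y + 1) * shifted_det_value (Suc n) (X - 2) (Y + 1) =
      S * (?G (Suc n) (s + 2) * ?G (Suc n) (s - 1)) * (?U (Suc n) (X + 2) * ?U (Suc n) (X - 1))
        * (run_prod (Suc n) (Y + 1) * run_prod (Suc n) (Y + 1)) * (q (Y - X) * q (X + 2 * Y))"
    unfolding shifted_det_value_def S_def q_def shift power2_eq_square by (simp only: mult_ac)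
  also have "\<dots> = of_int ((s + int n + 1) * (X - int n - 1) * (Y + 2 * int n + 2)) * Z"
    unfolding g2 u2 v2 Z_def of_int_mult by (simp only: mult_ac)
  finally have p12: "shifted_det_value (Suc n) (X + 1) (Y + 1) * shifted_det_value (Suc n) (X - 2) (Y + 1) =
      of_int ((s + int n + 1) * (X - int n - 1) * (Y + 2 * int n + 2)) * Z" .
  have "shifted_det_value (Suc (Suc n)) X Y * shifted_det_value n (X - 1) (Y + 2) =
      (superfact (Suc (Suc n)) * superfact n) * g * u * v
        * ((poch_prod (Suc (Suc n)) (Y - X) * poch_prod n (Y - X + 3))
        * (poch_prod (Suc (Suc n)) (X + 2 * Y) * poch_prod n (X + 2 * Y + 3)))"
    unfolding shifted_det_value_def g_def u_def v_def shift by (simp only: mult_ac)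
  also have "\<dots> = of_int ((int n + 1) * (Y - X + int n + 1) * (X + 2 * Y + int n + 1)) * Z"
    unfolding superfact_rel poch_prod_rel S_def[symmetric] q_def[symmetric] Z_def of_int_mult
    by (simp add: mult_ac)
  finally have p02: "shifted_det_value (Suc (Suc n)) X Y * shifted_det_value n (X - 1) (Y + 2) =
      of_int ((int n + 1) * (Y - X + int n + 1) * (X + 2 * Y + int n + 1)) * Z" .
  have "(int n + 1) * (Y - X + int n + 1) * (X + 2 * Y + int n + 1) =
      (s - int n - 1) * (X + int n + 1) * (Y + int n + 1)
        - (s + int n + 1) * (X - int n - 1) * (Y + 2 * int n + 2)"
    by (simp add: s_def algebra_simps)
  then show ?thesis
    unfolding p11 p12 p02 left_diff_distrib[symmetric] of_int_diff[symmetric] by (simp only:)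
qed

lemma shifted_det_value_nz:
  assumes "int n - 1 \<le> X" "X < Y"
  shows "shifted_det_value n X Y \<noteq> 0"
proof -
  have "step2_prod zfact n (X + Y) \<noteq> 0" by (simp add: step2_prod_def)
  moreover have "step2_prod inv_fact n (X + 1) \<noteq> 0" "run_prod n Y \<noteq> 0"
    using assms by (auto simp: step2_prod_def run_prod_def intro!: inv_fact_nz)
  moreover have "poch_prod n t \<noteq> 0" if "0 \<le> t" for t
  proof -
    have "0 < pochhammer (of_int (t + 3 * int j + 1) :: real) k" for j k
      using that by (intro pochhammer_pos iffD2[OF of_int_0_less_iff]) simp
    then show ?thesis by (simp only: poch_prod_def prod_pos less_imp_neq[symmetric] not_False_eq_True)
  qed
  moreover have "superfact n \<noteq> 0" by (simp add: superfact_def)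
  moreover have "poch_prod n (X + 2 * Y) \<noteq> 0"
  proof (cases "n = 0")
    case False
    then show ?thesis using assms \<open>\<And>t. 0 \<le> t \<Longrightarrow> poch_prod n t \<noteq> 0\<close>[of "X + 2 * Y"] by linarith
  qed (simp add: poch_prod_def)
  moreover have "poch_prod n (Y - X) \<noteq> 0"
    using assms \<open>\<And>t. 0 \<le> t \<Longrightarrow> poch_prod n t \<noteq> 0\<close>[of "Y - X"] by simp
  ultimately show ?thesis unfolding shifted_det_value_def by simp
qed

text \<open>Induction by condensation, which needs nonvanishing leading and inner minors. They are nonzero as long
  as \<open>n - 1 \<le> X\<close>. The recurrence also reaches \<open>X = n - 2\<close>; there the last
  column is zero, and so is the product.\<close>

lemma det_shifted_entry:
  assumes "int n - 2 \<le> X" "X < Y"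
  shows "det_of n (shifted_entry X Y) = shifted_det_value n X Y"
  using assms
proof (induction n arbitrary: X Y rule: less_induct)
  case (less n)
  consider "n = 0" | "n = 1" | "n \<ge> 2" "X = int n - 2" | k where "n = Suc (Suc k)" "int n - 1 \<le> X"
  proof (cases "n \<ge> 2 \<and> X \<noteq> int n - 2")
    case True
    then have "n = Suc (Suc (n - 2))" "int n - 1 \<le> X" using less.prems by auto
    then show ?thesis using that(4) by blast
  next
    case False
    then have "n = 0 \<or> n = 1 \<or> n \<ge> 2 \<and> X = int n - 2" by linarith
    then show ?thesis using that(1-3) by blast
  qed
  then show ?case
  proof cases
    case 1
    then show ?thesis
      by (simp add: shifted_det_value_def superfact_def step2_prod_def run_prod_def poch_prod_def)
  next
    case 2
    then show ?thesis
      by (simp add: det_of_Suc_0 shifted_entry_def shifted_det_value_def superfact_def step2_prod_def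
          run_prod_def poch_prod_def)
  next
    case 3
    have "step2_prod inv_fact n (X + 1) = 0"
      unfolding step2_prod_def using 3 by (intro prod_zero) (auto simp: inv_fact_def intro!: bexI[of _ 0])
    moreover have "det_of n (shifted_entry X Y) = 0"
      by (rule det_of_zero_col[of "n - 1"]) (use 3 in \<open>auto simp: shifted_entry_def inv_fact_def\<close>)
    ultimately show ?thesis by (simp add: shifted_det_value_def)
  next
    case (4 k)
    have ss: "(\<lambda>i j. shifted_entry X Y (Suc i) (Suc j)) = shifted_entry (X - 1) (Y + 2)"
      and s0: "(\<lambda>i j. shifted_entry X Y (Suc i) j) = shifted_entry (X + 1) (Y + 1)"
      and s1: "(\<lambda>i j. shifted_entry X Y i (Suc j)) = shifted_entry (X - 2) (Y + 1)"
      unfolding shifted_entry_def by (auto simp: fun_eq_iff algebra_simps)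
    have ih: "det_of (Suc k) (shifted_entry X Y) = shifted_det_value (Suc k) X Y"
      "det_of (Suc k) (shifted_entry (X - 1) (Y + 2)) = shifted_det_value (Suc k) (X - 1) (Y + 2)"
      "det_of (Suc k) (shifted_entry (X + 1) (Y + 1)) = shifted_det_value (Suc k) (X + 1) (Y + 1)"
      "det_of (Suc k) (shifted_entry (X - 2) (Y + 1)) = shifted_det_value (Suc k) (X - 2) (Y + 1)"
      "det_of k (shifted_entry (X - 1) (Y + 2)) = shifted_det_value k (X - 1) (Y + 2)"
      using 4 less.prems by (auto intro!: less.IH)
    have nz: "shifted_det_value (Suc k) X Y \<noteq> 0" "shifted_det_value k (X - 1) (Y + 2) \<noteq> 0"
      using shifted_det_value_nz[of "Suc k" X Y] shifted_det_value_nz[of k "X - 1" "Y + 2"] 4 less.prems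
      by auto
    have "det_of n (shifted_entry X Y) * shifted_det_value k (X - 1) (Y + 2) =
        shifted_det_value n X Y * shifted_det_value k (X - 1) (Y + 2)"
      using det_of_condensation[of k "shifted_entry X Y"] nz(1) 4 less.prems
      unfolding ss s0 s1 ih 4(1)
      by (subst shifted_det_value_condensation) auto
    then show ?thesis using nz(2) by simp
  qed
qed

section \<open>Free walks, reflection and the row reduction\<close>

lemma inv_fact_of_nat: "inv_fact (int k) = 1 / fact k"
  by (simp add: inv_fact_def)

definition zbinom :: "int \<Rightarrow> int \<Rightarrow> real" where
  "zbinom n r = (if 0 \<le> n \<and> 0 \<le> r then of_nat (nat n choose nat r) else 0)"

lemma zbinom_pascal:
  assumes "1 \<le> n"
  shows "zbinom n r = zbinom (n - 1) r + zbinom (n - 1) (r - 1)"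
proof -
  obtain k where n: "n = int (Suc k)" using assms by (metis zero_less_imp_eq_int gr0_implies_Suc zless_add1_eq
      add.commute int_one_le_iff_zero_less)
  show ?thesis
  proof (cases "1 \<le> r")
    case True
    then obtain i where "r = int (Suc i)" by (metis zero_less_imp_eq_int gr0_implies_Suc int_one_le_iff_zero_less)
    then show ?thesis by (simp add: n zbinom_def nat_add_distrib)
  next
    case False
    then show ?thesis by (cases "r = 0") (auto simp: n zbinom_def)
  qed
qed

lemma zbinom_fact:
  assumes "0 \<le> n"
  shows "zbinom n r = zfact n * inv_fact r * inv_fact (n - r)"
proof (cases "0 \<le> r \<and> r \<le> n")
  case True
  then show ?thesis
    by (simp add: zbinom_def zfact_def inv_fact_def binomial_fact nat_mono nat_diff_distrib)
next
  case False
  then show ?thesis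
    using assms by (auto simp: zbinom_def inv_fact_def binomial_eq_0)
qed

text \<open>The total weight of the paths with \<open>n\<close> steps, \<open>r\<close> of them in direction
  \<open>g\<close>, if a last step in direction \<open>f\<close> has weight \<open>1/2\<close> and every
  other step has weight 1.\<close>

definition walk_weight :: "int \<Rightarrow> int \<Rightarrow> real" where
  "walk_weight n r =
     (if n \<le> 0 then (if n = 0 \<and> r = 0 then 1 else 0) else zbinom (n - 1) r / 2 + zbinom (n - 1) (r - 1))"

lemma walk_weight_neg: "r < 0 \<Longrightarrow> walk_weight n r = 0"
  by (simp add: walk_weight_def zbinom_def)

lemma walk_weight_beyond: "n < r \<Longrightarrow> walk_weight n r = 0"
  by (auto simp: walk_weight_def zbinom_def binomial_eq_0)

lemma walk_weight_0: "walk_weight 0 r = (if r = 0 then 1 else 0)"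
  by (simp add: walk_weight_def)

lemma walk_weight_1_0: "walk_weight 1 0 = 1 / 2"
  by (simp add: walk_weight_def zbinom_def)

lemma walk_weight_rec:
  assumes "2 \<le> n \<or> r \<noteq> 0"
  shows "walk_weight n r = walk_weight (n - 1) r + walk_weight (n - 1) (r - 1)"
proof -
  consider "n \<le> 0" | "n = 1" | "2 \<le> n" by linarith
  then show ?thesis
  proof cases
    case 3
    then have "walk_weight n r = zbinom (n - 1) r / 2 + zbinom (n - 1) (r - 1)"
      and "walk_weight (n - 1) r = zbinom (n - 1 - 1) r / 2 + zbinom (n - 1 - 1) (r - 1)"
      and "walk_weight (n - 1) (r - 1) = zbinom (n - 1 - 1) (r - 1) / 2 + zbinom (n - 1 - 1) (r - 1 - 1)"
      by (simp_all add: walk_weight_def)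
    then show ?thesis
      using zbinom_pascal[of "n - 1" r] zbinom_pascal[of "n - 1" "r - 1"] 3 by (simp add: field_simps)
  next
    case 2
    then show ?thesis using assms by (auto simp: walk_weight_def zbinom_def binomial_eq_0)
  qed (use assms in \<open>auto simp: walk_weight_def\<close>)
qed

text \<open>Because of the halved last step, the two binomial coefficients add up to a single quotient of
  factorials times the linear factor \<open>n + r\<close>.\<close>

lemma walk_weight_product:
  assumes "1 \<le> n"
  shows "walk_weight n r = of_int (n + r) / 2 * (zfact (n - 1) * inv_fact (n - r) * inv_fact r)"
proof -
  have "walk_weight n r = zfact (n - 1) * (inv_fact r * inv_fact (n - r - 1) / 2 + inv_fact (r - 1) * inv_fact (n - r))"
    using assms by (simp add: walk_weight_def zbinom_fact algebra_simps)
  then show ?thesis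
    unfolding inv_fact_rec[symmetric] by (simp add: field_simps)
qed

lemma sum_choose_Suc_weighted:
  "(\<Sum>i\<le>Suc q. of_nat (Suc q choose i) * g i) = (\<Sum>i\<le>q. of_nat (q choose i) * (g i + g (Suc i) :: real))"
proof -
  have "(\<Sum>i\<le>Suc q. of_nat (Suc q choose i) * g i) =
      g 0 + (\<Sum>i\<le>q. of_nat (q choose i) * g (Suc i)) + (\<Sum>i\<le>q. of_nat (q choose Suc i) * g (Suc i))"
    by (subst sum.atMost_Suc_shift) (simp add: sum.distrib algebra_simps)
  moreover have "g 0 + (\<Sum>i\<le>q. of_nat (q choose Suc i) * g (Suc i)) = (\<Sum>i\<le>Suc q. of_nat (q choose i) * g i)"
    by (subst sum.atMost_Suc_shift) simp
  ultimately have "(\<Sum>i\<le>Suc q. of_nat (Suc q choose i) * g i) =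
      (\<Sum>i\<le>q. of_nat (q choose i) * g (Suc i)) + (\<Sum>i\<le>Suc q. of_nat (q choose i) * g i)"
    by (simp add: algebra_simps)
  then show ?thesis by (simp add: sum.distrib algebra_simps)
qed

lemma walk_weight_iterate:
  assumes "1 \<le> n"
  shows "walk_weight (n + int q) r = (\<Sum>i\<le>q. of_nat (q choose i) * walk_weight n (r - int i))"
proof (induction q arbitrary: r)
  case (Suc q)
  have "walk_weight (n + int (Suc q)) r = walk_weight (n + int q) r + walk_weight (n + int q) (r - 1)"
    using walk_weight_rec[of "n + int (Suc q)" r] assms by (simp add: algebra_simps)
  also have "\<dots> = (\<Sum>i\<le>q. of_nat (q choose i) * (walk_weight n (r - int i) + walk_weight n (r - int (Suc i))))"
    unfolding Suc.IH by (simp add: sum.distrib algebra_simps)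
  finally show ?case by (simp only: sum_choose_Suc_weighted[where g = "\<lambda>i. walk_weight n (r - int i)"])
qed simp

text \<open>The \<open>2 m + 2\<close> terms are paired symmetrically about the middle, using the symmetry of the
  binomial coefficients.\<close>

lemma sum_choose_folded:
  fixes g :: "nat \<Rightarrow> real"
  shows "(\<Sum>i\<le>2 * m + 1. of_nat (2 * m + 1 choose i) * g i) =
    (\<Sum>j\<le>m. of_nat (2 * m + 1 choose (m - j)) * (g (m + 1 + j) + g (m - j)))"
proof -
  let ?t = "\<lambda>i. of_nat (2 * m + 1 choose i) * g i"
  have "{..2 * m + 1} = {..m} \<union> {m + 1..2 * m + 1}" by auto
  then have "sum ?t {..2 * m + 1} = sum ?t {..m} + sum ?t {m + 1..2 * m + 1}"
    by (simp only:) (rule sum.union_disjoint, auto)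
  moreover have "sum ?t {..m} = (\<Sum>j\<le>m. ?t (m - j))"
    by (rule sum.reindex_bij_witness[of _ "\<lambda>j. m - j" "\<lambda>j. m - j"]) auto
  moreover have "sum ?t {m + 1..2 * m + 1} = (\<Sum>j\<le>m. of_nat (2 * m + 1 choose (m - j)) * g (m + 1 + j))"
  proof -
    have "(2 * m + 1 choose (m + 1 + j)) = (2 * m + 1 choose (m - j))" if "j \<le> m" for j
      using that binomial_symmetric[of "m + 1 + j" "2 * m + 1"] by simp
    then have "(\<Sum>j\<le>m. of_nat (2 * m + 1 choose (m - j)) * g (m + 1 + j)) = (\<Sum>j\<le>m. ?t (m + 1 + j))"
      by (intro sum.cong) (auto simp only: atMost_iff)
    also have "\<dots> = sum ?t {m + 1..2 * m + 1}"
      by (rule sum.reindex_bij_witness[of _ "\<lambda>j. j - (m + 1)" "\<lambda>j. m + 1 + j"]) auto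
    finally show ?thesis ..
  qed
  ultimately show ?thesis
    by (simp only: sum.distrib distrib_left add.commute)
qed

text \<open>Row \<open>j\<close> belongs to the starting point at distance \<open>2 j + 1\<close> from the wall
  and column \<open>l\<close> to an endpoint. The coefficients \<open>T\<close> distribute
  \<open>2 m + 1\<close> free steps symmetrically about the wall, so that the combined row counts walks with
  \<open>2 m + 1\<close> more steps from a single point.\<close>

lemma det_reflected_walks:
  fixes a b c :: nat
  assumes "b \<le> a" "a \<le> c"
  shows "det_of b (\<lambda>j l. walk_weight (int a + int c - int l) (int c + int l - int j)
          + walk_weight (int a + int c - int l) (int c + int l + 1 + int j)) =
    (\<Prod>m<b. of_nat (a + 2 * c + 3 * m + 2) / 2) * shifted_det_value b (int a) (int c + 1)"
    (is "det_of b ?H = _")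
proof -
  define T where "T m j = (if j \<le> m then real (2 * m + 1 choose (m - j)) else 0)" for m j
  have "(\<Sum>j<b. T m j * ?H j l) = of_nat (a + 2 * c + 3 * m + 2) / 2 * shifted_entry (int a) (int c + 1) m l"
    if "m < b" "l < b" for m l
  proof -
    let ?n = "int a + int c - int l" and ?R = "int c + int l + int m + 1"
    have "(\<Sum>j<b. T m j * ?H j l) = (\<Sum>j\<le>m. T m j * ?H j l)"
      using that by (intro sum.mono_neutral_right) (auto simp: T_def)
    also have "\<dots> = (\<Sum>j\<le>m. of_nat (2 * m + 1 choose (m - j)) *
        (walk_weight ?n (?R - int (m + 1 + j)) + walk_weight ?n (?R - int (m - j))))"
      by (intro sum.cong refl) (auto simp: T_def of_nat_diff algebra_simps)
    also have "\<dots> = walk_weight (?n + int (2 * m + 1)) ?R"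
      using walk_weight_iterate[of ?n "2 * m + 1" ?R] that assms
        sum_choose_folded[of m "\<lambda>i. walk_weight ?n (?R - int i)"] by simp
    also have "\<dots> = of_nat (a + 2 * c + 3 * m + 2) / 2 * shifted_entry (int a) (int c + 1) m l"
      using walk_weight_product[of "?n + int (2 * m + 1)" ?R] that assms
      by (simp add: shifted_entry_def algebra_simps)
    finally show ?thesis .
  qed
  then have "det_of b T * det_of b ?H =
      det_of b (\<lambda>m l. of_nat (a + 2 * c + 3 * m + 2) / 2 * shifted_entry (int a) (int c + 1) m l)"
    unfolding det_of_mult[symmetric] by (rule det_of_cong)
  also have "det_of b T = 1" by (rule det_of_unitriangular) (auto simp: T_def)
  finally show ?thesis
    unfolding det_of_scale_rows using det_shifted_entry[of b "int a" "int c + 1"] assms by simp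
qed

lemma shifted_det_value_nat:
  fixes a b c :: nat
  assumes "b \<le> a" "a \<le> c"
  shows "(\<Prod>m<b. of_nat (a + 2 * c + 3 * m + 2) / 2) * shifted_det_value b (int a) (int c + 1) =
    (1 / 2) ^ b * (\<Prod>j = 1..b.
       fact (j - 1) * fact (a + c - b + 2 * j - 1)
         * pochhammer (real (c - a + 3 * j - 1)) (b - j)
         * pochhammer (real (a + 2 * c + 3 * j - 1)) (b - j + 1)
       / (fact (b + c + j - 1) * fact (a - b + 2 * j - 1)))"
proof -
  have "(\<Prod>j = 1..b. fact (j - 1) * fact (a + c - b + 2 * j - 1)
         * pochhammer (real (c - a + 3 * j - 1)) (b - j)
         * pochhammer (real (a + 2 * c + 3 * j - 1)) (b - j + 1)
       / (fact (b + c + j - 1) * fact (a - b + 2 * j - 1))) =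
     (\<Prod>j<b. fact (Suc j - 1) * fact (a + c - b + 2 * Suc j - 1)
         * pochhammer (real (c - a + 3 * Suc j - 1)) (b - Suc j)
         * pochhammer (real (a + 2 * c + 3 * Suc j - 1)) (b - Suc j + 1)
       / (fact (b + c + Suc j - 1) * fact (a - b + 2 * Suc j - 1)) :: real)"
    by (rule prod.reindex_bij_witness[of _ Suc "\<lambda>j. j - 1"]) auto
  also have "\<dots> = (\<Prod>j<b. of_nat (a + 2 * c + 3 * j + 2) * (fact j * zfact (int a + (int c + 1) - int b + 2 * int j)
      * inv_fact (int a + 1 - int b + 2 * int j) * inv_fact (int c + 1 + int b + int j - 1)
      * (pochhammer (of_int (int c + 1 - int a + 3 * int j + 1)) (b - 1 - j)
      * pochhammer (of_int (int a + 2 * (int c + 1) + 3 * int j + 1)) (b - 1 - j))))"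
  proof (intro prod.cong refl)
    fix j assume "j \<in> {..<b}"
    then have j: "j < b" by simp
    have "zfact (int a + (int c + 1) - int b + 2 * int j) = fact (a + c - b + 2 * Suc j - 1)"
    proof -
      have "int a + (int c + 1) - int b + 2 * int j = int (a + c - b + 2 * Suc j - 1)"
        using assms by (simp add: of_nat_diff)
      then show ?thesis unfolding zfact_def by (simp only: nat_int)
    qed
    moreover have "inv_fact (int a + 1 - int b + 2 * int j) = 1 / fact (a - b + 2 * Suc j - 1)"
    proof -
      have "int a + 1 - int b + 2 * int j = int (a - b + 2 * Suc j - 1)" using assms by (simp add: of_nat_diff)
      then show ?thesis by (simp only: inv_fact_of_nat)
    qed
    moreover have "inv_fact (int c + 1 + int b + int j - 1) = 1 / fact (b + c + Suc j - 1)"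
    proof -
      have "int c + 1 + int b + int j - 1 = int (b + c + Suc j - 1)" by linarith
      then show ?thesis by (simp only: inv_fact_of_nat)
    qed
    moreover have "real_of_int (int c + 1 - int a + 3 * int j + 1) = real (c - a + 3 * Suc j - 1)"
      using assms by simp
    moreover have "pochhammer (real (a + 2 * c + 3 * Suc j - 1)) (b - Suc j + 1) = of_nat (a + 2 * c + 3 * j + 2) *
        pochhammer (of_int (int a + 2 * (int c + 1) + 3 * int j + 1)) (b - 1 - j)"
      using j by (simp add: pochhammer_rec algebra_simps)
    ultimately show "fact (Suc j - 1) * fact (a + c - b + 2 * Suc j - 1)
         * pochhammer (real (c - a + 3 * Suc j - 1)) (b - Suc j)
         * pochhammer (real (a + 2 * c + 3 * Suc j - 1)) (b - Suc j + 1)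
       / (fact (b + c + Suc j - 1) * fact (a - b + 2 * Suc j - 1)) =
       of_nat (a + 2 * c + 3 * j + 2) * (fact j * zfact (int a + (int c + 1) - int b + 2 * int j)
      * inv_fact (int a + 1 - int b + 2 * int j) * inv_fact (int c + 1 + int b + int j - 1)
      * (pochhammer (of_int (int c + 1 - int a + 3 * int j + 1)) (b - 1 - j)
      * pochhammer (of_int (int a + 2 * (int c + 1) + 3 * int j + 1)) (b - 1 - j)))"
      by (simp only:) (simp add: mult_ac)
  qed
  also have "\<dots> = (\<Prod>j<b. of_nat (a + 2 * c + 3 * j + 2)) * shifted_det_value b (int a) (int c + 1)"
    unfolding shifted_det_value_def superfact_def step2_prod_def run_prod_def poch_prod_def prod.distrib ..
  finally show ?thesis
    by (simp add: prod_dividef power_one_over)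
qed

section \<open>Weighted sums over lozenge tilings\<close>

text \<open>The unit triangles above and below the horizontal edge from \<open>p\<close> to \<open>p + e\<close>.\<close>

definition up :: "lattice_point \<Rightarrow> triangle" where
  "up p = {p, p + (1, 0), p + (0, 1)}"

definition down :: "lattice_point \<Rightarrow> triangle" where
  "down p = {p, p + (1, 0), p + (1, -1)}"

text \<open>The positions \<open>q\<close> for which \<open>up p\<close> and \<open>down q\<close> form a lozenge:
  the edge \<open>p\<close> is its short diagonal, or a path through \<open>p\<close> continues with a step
  \<open>f\<close> or \<open>g\<close>.\<close>

definition mates :: "lattice_point \<Rightarrow> lattice_point set" where
  "mates p = {p, p + (0, 1), p + (-1, 1)}"

lemma mem_up: "(u, v) \<in> up (x, y) \<longleftrightarrow> u = x \<and> v = y \<or> u = x + 1 \<and> v = y \<or> u = x \<and> v = y + 1"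
  by (auto simp: up_def)

lemma mem_down:
  "(u, v) \<in> down (x, y) \<longleftrightarrow> u = x \<and> v = y \<or> u = x + 1 \<and> v = y \<or> u = x + 1 \<and> v = y - 1"
  by (auto simp: down_def)

lemma mem_mates:
  "(u, v) \<in> mates (x, y) \<longleftrightarrow> u = x \<and> v = y \<or> u = x \<and> v = y + 1 \<or> u = x - 1 \<and> v = y + 1"
  by (auto simp: mates_def)

lemma unit_triangle_iff: "unit_triangle t \<longleftrightarrow> (\<exists>p. t = up p \<or> t = down p)"
proof -
  have "{p, p + vec_f, p + vec_g} = down (p + (-1, 1))" for p
    by (cases p) (auto simp: down_def vec_f_def vec_g_def vec_e_def)
  moreover have "down p = {p + (1, -1), p + (1, -1) + vec_f, p + (1, -1) + vec_g}" for p
    by (cases p) (auto simp: down_def vec_f_def vec_g_def vec_e_def)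
  moreover have "{p, p + vec_e, p + vec_f} = up p" for p
    by (simp add: up_def vec_e_def vec_f_def)
  ultimately show ?thesis unfolding unit_triangle_def by metis
qed

lemma card_Int_insert3:
  assumes "a \<noteq> b" "a \<noteq> c" "b \<noteq> c"
  shows "card ({a, b, c} \<inter> U) = of_bool (a \<in> U) + of_bool (b \<in> U) + of_bool (c \<in> U)"
  using assms by (auto simp: Int_insert_left)

lemma card_up_Int: "card (up p \<inter> U) =
    of_bool (p \<in> U) + of_bool (p + (1, 0) \<in> U) + of_bool (p + (0, 1) \<in> U)"
  unfolding up_def by (cases p) (rule card_Int_insert3, auto)

lemma card_down_Int: "card (down p \<inter> U) =
    of_bool (p \<in> U) + of_bool (p + (1, 0) \<in> U) + of_bool (p + (1, -1) \<in> U)"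
  unfolding down_def by (cases p) (rule card_Int_insert3, auto)

lemma card_up_Int_up: "card (up p \<inter> up q) \<noteq> 2"
proof -
  obtain x y u v where "p = (x, y)" "q = (u, v)" by (cases p, cases q)
  then show ?thesis unfolding card_up_Int by (simp add: mem_up of_bool_def)
qed

lemma card_down_Int_down: "card (down p \<inter> down q) \<noteq> 2"
proof -
  obtain x y u v where "p = (x, y)" "q = (u, v)" by (cases p, cases q)
  then show ?thesis unfolding card_down_Int by (simp add: mem_down of_bool_def)
qed

lemma card_up_Int_down: "card (up p \<inter> down q) = 2 \<longleftrightarrow> q \<in> mates p"
proof -
  obtain x y u v where "p = (x, y)" "q = (u, v)" by (cases p, cases q)
  then show ?thesis unfolding card_up_Int by (simp add: mem_down mem_mates of_bool_def) presburger
qed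

lemma up_eq_iff [simp]: "up p = up q \<longleftrightarrow> p = q"
proof
  obtain x y u v where *: "p = (x, y)" "q = (u, v)" by (cases p, cases q)
  assume "up p = up q"
  moreover have "(x, y) \<in> up (x, y)" "(u, v) \<in> up (u, v)" by (simp_all add: mem_up)
  ultimately have "(x, y) \<in> up (u, v)" "(u, v) \<in> up (x, y)" by (simp_all only: *)
  then show "p = q" unfolding mem_up * by auto
qed simp

lemma down_eq_iff [simp]: "down p = down q \<longleftrightarrow> p = q"
proof
  obtain x y u v where *: "p = (x, y)" "q = (u, v)" by (cases p, cases q)
  assume "down p = down q"
  moreover have "(x, y) \<in> down (x, y)" "(u, v) \<in> down (u, v)" by (simp_all add: mem_down)
  ultimately have "(x, y) \<in> down (u, v)" "(u, v) \<in> down (x, y)" by (simp_all only: *)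
  then show "p = q" unfolding mem_down * by auto
qed simp

lemma up_neq_down [simp]: "up p \<noteq> down q" "down q \<noteq> up p"
proof -
  show "up p \<noteq> down q"
  proof
    obtain x y u v where *: "p = (x, y)" "q = (u, v)" by (cases p, cases q)
    assume "up p = down q"
    moreover have "(x, y) \<in> up (x, y)" "(x + 1, y) \<in> up (x, y)" "(x, y + 1) \<in> up (x, y)"
      by (simp_all add: mem_up)
    ultimately have "(x, y) \<in> down (u, v)" "(x + 1, y) \<in> down (u, v)" "(x, y + 1) \<in> down (u, v)"
      by (simp_all only: *)
    then show False unfolding mem_down by auto
  qed
  then show "down q \<noteq> up p" by metis
qed

lemma lozenge_doubleton:
  "lozenge {t, u} \<longleftrightarrow> unit_triangle t \<and> unit_triangle u \<and> card (t \<inter> u) = 2"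
  unfolding lozenge_def by (metis Int_commute doubleton_eq_iff)

lemma lozenge_up: "lozenge {up p, t} \<longleftrightarrow> (\<exists>q\<in>mates p. t = down q)"
  unfolding lozenge_doubleton unit_triangle_iff using card_up_Int_up card_up_Int_down by metis

lemma lozenge_down: "lozenge {down q, t} \<longleftrightarrow> (\<exists>p. q \<in> mates p \<and> t = up p)"
  unfolding lozenge_doubleton unit_triangle_iff
  using card_down_Int_down card_up_Int_down Int_commute by metis

lemma lozengeE:
  assumes "lozenge l" "t \<in> l"
  obtains u where "l = {t, u}"
proof -
  obtain a b where "l = {a, b}" using assms by (auto simp: lozenge_def)
  then have "l = {t, b} \<or> l = {t, a}" using assms by auto
  then show ?thesis using that by blast
qed

definition tiling_sum :: "(triangle set \<Rightarrow> real) \<Rightarrow> triangle set \<Rightarrow> real" where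
  "tiling_sum w R = (\<Sum>T\<in>lozenge_tilings R. \<Prod>l\<in>T. w l)"

lemma tiling_sum_empty [simp]: "tiling_sum w {} = 1"
proof -
  have "lozenge_tilings {} = {{}}" by (auto simp: lozenge_tilings_def partition_on_empty)
  then show ?thesis by (simp add: tiling_sum_def)
qed

lemma lozenge_tilings_split:
  assumes "t \<in> R"
  shows "lozenge_tilings R =
    (\<Union>u\<in>{u\<in>R. lozenge {t, u}}. insert {t, u} ` lozenge_tilings (R - {t, u}))"
proof (intro equalityI subsetI)
  fix T assume T: "T \<in> lozenge_tilings R"
  then have part: "partition_on R T" and loz: "\<And>l. l \<in> T \<Longrightarrow> lozenge l"
    by (auto simp: lozenge_tilings_def)
  obtain l where l: "l \<in> T" "t \<in> l" using part assms by (auto simp: partition_on_def)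
  obtain u where u: "l = {t, u}" using lozengeE[OF loz[OF l(1)] l(2)] .
  have Tl: "T = insert {t, u} (T - {l})" using l u by auto
  have "l \<inter> m = {}" if "m \<in> T - {l}" for m
    using disjointD[OF partition_onD2[OF part] l(1), of m] that by blast
  then have "disjnt {t, u} (\<Union>(T - {l}))" unfolding disjnt_def u[symmetric] by blast
  then have "partition_on (R - {t, u}) (T - {l})" "{t, u} \<subseteq> R"
    using part partition_on_insert[of "{t, u}" "T - {l}" R] Tl by auto
  moreover from this have "T - {l} \<in> lozenge_tilings (R - {t, u})"
    using loz by (auto simp: lozenge_tilings_def)
  moreover have "lozenge {t, u}" using loz l u by metis
  ultimately show "T \<in> (\<Union>u\<in>{u\<in>R. lozenge {t, u}}. insert {t, u} ` lozenge_tilings (R - {t, u}))"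
    using Tl by (intro UN_I[of u] image_eqI[of _ _ "T - {l}"]) auto
next
  fix T assume "T \<in> (\<Union>u\<in>{u\<in>R. lozenge {t, u}}. insert {t, u} ` lozenge_tilings (R - {t, u}))"
  then obtain u T' where u: "u \<in> R" "lozenge {t, u}" and T: "T = insert {t, u} T'"
    and T': "partition_on (R - {t, u}) T'" "\<forall>l\<in>T'. lozenge l"
    by (auto simp: lozenge_tilings_def)
  have "disjnt {t, u} (\<Union>T')" using T'(1) by (auto simp: partition_on_def disjnt_def)
  then have "partition_on R T"
    unfolding T using partition_on_insert[of "{t, u}" T' R] T' u assms by auto
  then show "T \<in> lozenge_tilings R" using T T' u by (auto simp: lozenge_tilings_def)
qed

text \<open>The basic recurrence: the cases are the possible partners \<open>u\<close> of one fixed triangle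
  \<open>t\<close>.\<close>

lemma tiling_sum_split:
  assumes "finite R" "t \<in> R"
  shows "tiling_sum w R = (\<Sum>u\<in>{u\<in>R. lozenge {t, u}}. w {t, u} * tiling_sum w (R - {t, u}))"
proof -
  have notin: "{t, u} \<notin> T" if "T \<in> lozenge_tilings (R - {t, u})" for u T
    using that by (auto simp: lozenge_tilings_def partition_on_def)
  have block: "u = v" if "{t, v} \<in> insert {t, u} T" "T \<in> lozenge_tilings (R - {t, u})" for u v T
    using that by (auto simp: lozenge_tilings_def partition_on_def doubleton_eq_iff)
  have fin: "finite (lozenge_tilings S)" if "S \<subseteq> R" for S
    using finite_lozenge_tilings finite_subset[OF that assms(1)] by blast
  have finT: "finite T" if "T \<in> lozenge_tilings S" "S \<subseteq> R" for S T
    using that finite_elements[OF finite_subset[OF _ assms(1)]] by (auto simp: lozenge_tilings_def)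
  have "tiling_sum w R =
      (\<Sum>u\<in>{u\<in>R. lozenge {t, u}}. \<Sum>T\<in>insert {t, u} ` lozenge_tilings (R - {t, u}). \<Prod>l\<in>T. w l)"
    unfolding tiling_sum_def lozenge_tilings_split[OF assms(2)]
  proof (rule sum.UNION_disjoint)
    show "\<forall>i\<in>{u \<in> R. lozenge {t, u}}. \<forall>j\<in>{u \<in> R. lozenge {t, u}}. i \<noteq> j \<longrightarrow>
        insert {t, i} ` lozenge_tilings (R - {t, i}) \<inter> insert {t, j} ` lozenge_tilings (R - {t, j}) = {}"
    proof (intro ballI impI equals0I)
      fix i j X assume "i \<noteq> j"
        "X \<in> insert {t, i} ` lozenge_tilings (R - {t, i}) \<inter> insert {t, j} ` lozenge_tilings (R - {t, j})"
      then obtain T T' where T: "T \<in> lozenge_tilings (R - {t, i})" "X = insert {t, i} T" "X = insert {t, j} T'"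
        by (elim IntE imageE)
      then have "{t, j} \<in> insert {t, i} T" by (metis insertI1)
      then show False using block[OF _ T(1)] \<open>i \<noteq> j\<close> by metis
    qed
  qed (use assms fin in auto)
  also have "\<dots> = (\<Sum>u\<in>{u\<in>R. lozenge {t, u}}. w {t, u} * tiling_sum w (R - {t, u}))"
  proof (intro sum.cong refl)
    fix u
    have "inj_on (insert {t, u}) (lozenge_tilings (R - {t, u}))"
      using notin by (intro inj_onI) (metis insert_ident)
    then show "(\<Sum>T\<in>insert {t, u} ` lozenge_tilings (R - {t, u}). \<Prod>l\<in>T. w l) =
        w {t, u} * tiling_sum w (R - {t, u})"
      unfolding tiling_sum_def sum_distrib_left
      by (subst sum.reindex) (auto intro!: sum.cong prod.insert simp: notin finT)
  qed
  finally show ?thesis .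
qed

definition region :: "lattice_point set \<Rightarrow> lattice_point set \<Rightarrow> triangle set" where
  "region A B = up ` A \<union> down ` B"

lemma finite_region: "finite A \<Longrightarrow> finite B \<Longrightarrow> finite (region A B)"
  by (simp add: region_def)

lemma region_remove: "region A B - {up p, down q} = region (A - {p}) (B - {q})"
  by (auto simp: region_def)

lemma tiling_sum_region_up:
  assumes "finite A" "finite B" "p \<in> A"
  shows "tiling_sum w (region A B) =
    (\<Sum>q\<in>B \<inter> mates p. w {up p, down q} * tiling_sum w (region (A - {p}) (B - {q})))"
proof -
  have "{u \<in> region A B. lozenge {up p, u}} = down ` (B \<inter> mates p)"
    by (auto simp: region_def lozenge_up)
  moreover have "inj_on down X" for X by (simp add: inj_on_def)
  moreover have "up p \<in> region A B" using assms(3) by (simp add: region_def)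
  ultimately show ?thesis
    using tiling_sum_split[OF finite_region[OF assms(1,2)], of "up p" w]
    by (simp add: sum.reindex region_remove)
qed

lemma tiling_sum_region_down:
  assumes "finite A" "finite B" "q \<in> B"
  shows "tiling_sum w (region A B) =
    (\<Sum>p\<in>{p\<in>A. q \<in> mates p}. w {up p, down q} * tiling_sum w (region (A - {p}) (B - {q})))"
proof -
  have "{u \<in> region A B. lozenge {down q, u}} = up ` {p\<in>A. q \<in> mates p}"
    by (auto simp: region_def lozenge_down)
  moreover have "inj_on up X" for X by (simp add: inj_on_def)
  moreover have "down q \<in> region A B" using assms(3) by (simp add: region_def)
  moreover have "{down q, up p} = {up p, down q}" for p by (rule insert_commute)
  ultimately show ?thesis
    using tiling_sum_split[OF finite_region[OF assms(1,2)], of "down q" w]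
    by (simp add: sum.reindex region_remove)
qed

section \<open>The sweep\<close>

text \<open>With \<open>n\<close> steps to go, \<open>r\<close> of them to the left, and the endpoint at distance
  \<open>D\<close> from the wall, the mirror image of the current point has to make \<open>n - r + D\<close>
  steps to the left. The point itself is not beyond the wall if and only if
  \<open>r \<le> n - r + D\<close>.\<close>

definition reflected_weight :: "int \<Rightarrow> int \<Rightarrow> int \<Rightarrow> real" where
  "reflected_weight D n r = walk_weight n r + walk_weight n (n - r + D)"

lemma reflected_weight_rec:
  assumes "2 \<le> n + r" "r \<le> n - r + D"
  shows "reflected_weight D n r = reflected_weight D (n - 1) r + reflected_weight D (n - 1) (r - 1)"
proof -
  have "walk_weight n r = walk_weight (n - 1) r + walk_weight (n - 1) (r - 1)"
    by (rule walk_weight_rec) (use assms in linarith)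
  moreover have "walk_weight n (n - r + D) = walk_weight (n - 1) (n - r + D) + walk_weight (n - 1) (n - r + D - 1)"
    by (rule walk_weight_rec) (use assms in linarith)
  moreover have shift: "n - 1 - r + D = n - r + D - 1" "n - 1 - (r - 1) + D = n - r + D" by simp_all
  ultimately show ?thesis unfolding reflected_weight_def shift by linarith
qed

lemma reflected_weight_neg:
  assumes "1 \<le> D" "r < 0"
  shows "reflected_weight D n r = 0"
  using assms by (simp add: reflected_weight_def walk_weight_neg walk_weight_beyond)

lemma reflected_weight_beyond:
  assumes "n < r" "r \<le> n - r + D"
  shows "reflected_weight D n r = 0"
  using assms by (simp add: reflected_weight_def walk_weight_beyond)

text \<open>A step \<open>f\<close> lowers \<open>n + r\<close> by one and a step \<open>g\<close> by two. So from
  the cut, where \<open>n + r = 0\<close>, only the empty path remains, and one unit before the cut only a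
  single step \<open>f\<close>.\<close>

lemma reflected_weight_on_cut:
  assumes "1 \<le> D" "r \<le> n - r + D" "n + r = 0"
  shows "reflected_weight D n r = of_bool (r = 0)"
proof -
  consider "r < 0" | "r = 0" | "0 < r" by linarith
  then show ?thesis
  proof cases
    case 1 then show ?thesis using assms by (simp add: reflected_weight_neg)
  next
    case 2 then show ?thesis using assms by (simp add: reflected_weight_def walk_weight_0)
  next
    case 3 then show ?thesis using assms by (simp add: reflected_weight_beyond)
  qed
qed

lemma reflected_weight_before_cut:
  assumes "1 \<le> D" "r \<le> n - r + D" "n + r = 1"
  shows "reflected_weight D n r = of_bool (r = 0) / 2"
proof -
  consider "r < 0" | "r = 0" | "0 < r" by linarith
  then show ?thesis
  proof cases
    case 1 then show ?thesis using assms by (simp add: reflected_weight_neg)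
  next
    case 2 then show ?thesis
      using assms by (simp add: reflected_weight_def walk_weight_1_0 walk_weight_beyond)
  next
    case 3 then show ?thesis using assms by (simp add: reflected_weight_beyond)
  qed
qed

locale dented_sizes =
  fixes a b c :: nat
  assumes pos: "0 < b" and ba: "b \<le> a" and ac: "a \<le> c"
begin

text \<open>The endpoints of the paths are the edges on the line \<open>y - x = nw_cut\<close>, on the zig-zag at
  the northwestern corner.\<close>

definition nw_cut :: int where "nw_cut = int a + 2 * int c - int b + 1"

text \<open>The up triangles of the dented hexagon, by their bottom edges, and the down triangles, by their top
  edges. The set \<open>downs\<close> has an additional row \<open>y = 0\<close> outside the region: with
  all starting points occupied, the edges on the bottom side are then treated like every other edge.\<close>

definition ups :: "lattice_point set" where
  "ups = {(x, y). - int c \<le> x \<and> 0 \<le> x + y \<and> y - x < nw_cut \<and> x + y < int a + int b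
     \<and> 2 * x + y < 2 * int b \<and> 0 \<le> y \<and> y < int a + int c}"

definition downs :: "lattice_point set" where
  "downs = {(x, y). - int c \<le> x \<and> 0 \<le> x + y \<and> y - x \<le> nw_cut \<and> x + y < int a + int b
     \<and> 2 * x + y < 2 * int b \<and> 0 \<le> y \<and> y \<le> int a + int c}"

definition wall :: "lattice_point set" where
  "wall = {(x, y). 2 * x + y = 2 * int b - 1}"

definition end_x :: "nat \<Rightarrow> int" where "end_x l = int b - int c - 1 - int l"
definition end_y :: "nat \<Rightarrow> int" where "end_y l = int a + int c - int l"

text \<open>The weight of all paths from the edge \<open>(x, y)\<close> to endpoint \<open>l\<close>; the
  endpoints are numbered from right to left. The first argument of \<open>reflected_weight\<close> is the
  distance of the endpoint from the wall. A path that has reached the cut stays in its column for the rest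
  of the sweep.\<close>

definition path_weight :: "nat \<Rightarrow> int \<Rightarrow> int \<Rightarrow> real" where
  "path_weight l x y =
     (if y - x < nw_cut then reflected_weight (int c - int a + 1 + 3 * int l) (end_y l - y) (x - end_x l)
      else of_bool (x = end_x l))"

lemma finite_ups: "finite ups" and finite_downs: "finite downs"
proof -
  show "finite ups" by (rule finite_subset[of _ "{- int c..int b} \<times> {0..int a + int c}"]) (auto simp: ups_def)
  show "finite downs" by (rule finite_subset[of _ "{- int c..int b} \<times> {0..int a + int c}"]) (auto simp: downs_def)
qed

text \<open>The weights satisfy the recurrence of paths in the region: a factor 2 on leaving the wall, weight
  \<open>1/2\<close> for a last step \<open>f\<close>, and no step that leaves the region. Away from the
  wall and the cut it is Pascal's rule, and the weights beyond the remaining sides vanish by themselves. On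
  the wall the point is its own mirror image, so the two terms of Pascal's rule coincide, which gives the
  factor 2.\<close>

lemma path_weight_step:
  assumes p: "(x, y) \<in> ups" and l: "l < b"
  shows "path_weight l x y = (if (x, y) \<in> wall then 2 else 1) *
    ((if (x, y + 1) \<in> downs then (if y - x = nw_cut - 1 then 1 / 2 else 1) else 0) * path_weight l x (y + 1)
      + (if (x - 1, y + 1) \<in> downs then 1 else 0) * path_weight l (x - 1) (y + 1))"
proof -
  \<comment> \<open>\<open>D\<close> is the distance of the endpoint from the wall, \<open>n\<close> the number of steps to the endpoint,
    \<open>r\<close> the number of those to the left.\<close>
  define D where "D = int c - int a + 1 + 3 * int l"
  define n where "n = end_y l - y"
  define r where "r = x - end_x l"
  have D: "1 \<le> D" using ac by (simp add: D_def)
  have nr: "n + r = nw_cut - (y - x)" by (simp add: n_def r_def end_x_def end_y_def nw_cut_def)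
  have mirror: "n - r + D = r + (2 * int b - 1 - 2 * x - y)"
    by (simp add: n_def r_def end_x_def end_y_def D_def)
  have le: "r \<le> n - r + D" using p unfolding mirror by (simp add: ups_def)
  have here: "path_weight l x y = reflected_weight D n r"
    using p by (simp add: path_weight_def D_def n_def r_def ups_def)
  show ?thesis
  proof (cases "y - x = nw_cut - 1")
    case True
    have "(x - 1, y + 1) \<notin> downs" using True by (simp add: downs_def)
    moreover have "path_weight l x (y + 1) = of_bool (r = 0)"
      using True by (simp add: path_weight_def r_def)
    moreover have "path_weight l x y = of_bool (r = 0) / 2"
      unfolding here by (rule reflected_weight_before_cut) (use D le nr True in auto)
    moreover have "(x, y + 1) \<in> downs \<and> (x, y) \<notin> wall" if "r = 0"
      using that p True mirror nr D l
      by (auto simp: downs_def ups_def wall_def r_def n_def end_x_def end_y_def nw_cut_def)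
    ultimately show ?thesis using True by auto
  next
    case False
    then have lt: "y - x < nw_cut - 1" using p by (simp add: ups_def)
    have up: "path_weight l x (y + 1) = reflected_weight D (n - 1) r"
      using lt by (simp add: path_weight_def D_def n_def r_def diff_diff_eq)
    have left: "path_weight l (x - 1) (y + 1) = reflected_weight D (n - 1) (r - 1)"
    proof (cases "y + 2 - x < nw_cut")
      case True
      then show ?thesis by (simp add: path_weight_def D_def n_def r_def algebra_simps)
    next
      case False
      then have "reflected_weight D (n - 1) (r - 1) = of_bool (r - 1 = 0)"
        by (intro reflected_weight_on_cut) (use D le nr lt in linarith)+
      then show ?thesis using False by (auto simp: path_weight_def r_def)
    qed
    have rec: "path_weight l x y = path_weight l x (y + 1) + path_weight l (x - 1) (y + 1)"
      unfolding here up left by (rule reflected_weight_rec) (use nr lt le in linarith)+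
    have left0: "path_weight l (x - 1) (y + 1) = 0" if "(x - 1, y + 1) \<notin> downs"
    proof -
      have "x = - int c" using that p lt by (auto simp: downs_def ups_def)
      then show ?thesis unfolding left using D l
        by (intro reflected_weight_neg) (auto simp: r_def end_x_def)
    qed
    show ?thesis
    proof (cases "(x, y) \<in> wall")
      case True
      then have "n - r + D = r" using mirror by (simp add: wall_def)
      then have "reflected_weight D (n - 1) r = reflected_weight D (n - 1) (r - 1)"
        by (simp add: reflected_weight_def algebra_simps)
      moreover have "(x, y + 1) \<notin> downs" using True by (simp add: downs_def wall_def)
      ultimately show ?thesis using rec left0 True up left by auto
    next
      case notwall: False
      have "path_weight l x (y + 1) = 0" if "(x, y + 1) \<notin> downs"
      proof -
        have "x + y = int a + int b - 1" using that p lt notwall by (auto simp: downs_def ups_def wall_def)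
        then have "n \<le> r" by (simp add: n_def r_def end_x_def end_y_def)
        moreover have "r + 1 \<le> n - r + D" using notwall p unfolding mirror by (simp add: ups_def wall_def)
        ultimately show ?thesis unfolding up by (intro reflected_weight_beyond) auto
      qed
      then show ?thesis using rec left0 notwall lt by auto
    qed
  qed
qed

lemma path_weight_after_cut:
  assumes "nw_cut \<le> y - x"
  shows "path_weight l x (y + 1) = path_weight l x y"
  using assms by (simp add: path_weight_def)

text \<open>A path which is still to the right of an endpoint when it has reached the height of that endpoint
  cannot end there.\<close>

lemma path_weight_beside_end:
  assumes "end_x l < z" "(z, end_y l) \<in> downs"
  shows "path_weight l z (end_y l) = 0"
proof -
  have "end_y l - z < nw_cut" using assms(1) by (simp add: nw_cut_def end_x_def end_y_def)
  moreover have "0 < int c - int a + 1 + 3 * int l - (z - end_x l)"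
    using assms by (auto simp: downs_def end_x_def end_y_def)
  ultimately show ?thesis using assms(1) by (simp add: path_weight_def reflected_weight_def walk_weight_0)
qed

text \<open>The sweep visits the edges of a row from left to right and the rows from bottom to top. When it stands
  at \<open>(x, y)\<close>, all up triangles before \<open>(x, y)\<close> are already covered. So a path at
  position \<open>z < x\<close> has made its step to row \<open>y + 1\<close>, while a path at
  \<open>z \<ge> x\<close> is still in row \<open>y\<close>.\<close>

definition level :: "int \<Rightarrow> int \<Rightarrow> int \<Rightarrow> int" where
  "level x y z = (if z < x then y + 1 else y)"

lemma level_next: "z \<noteq> x \<Longrightarrow> level (x + 1) y z = level x y z"
  by (auto simp: level_def)

text \<open>The triangles not yet covered if the paths are at the positions \<open>S\<close>: a down triangle
  below an edge occupied by a path is covered by the preceding lozenge of that path.\<close>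

definition rem_ups :: "int \<Rightarrow> int \<Rightarrow> lattice_point set" where
  "rem_ups x y = {(u, v) \<in> ups. y < v \<or> v = y \<and> x \<le> u}"

definition rem_downs :: "int \<Rightarrow> int \<Rightarrow> int set \<Rightarrow> lattice_point set" where
  "rem_downs x y S =
     {(u, v) \<in> downs. y + 1 < v \<or> v = y + 1 \<and> (x \<le> u \<or> u \<notin> S) \<or> v = y \<and> x \<le> u \<and> u \<notin> S}"

text \<open>The possible positions of the paths, numbered from right to left as the endpoints are. The second
  alternative is a path that has ended on the cut.\<close>

definition state :: "int \<Rightarrow> int \<Rightarrow> (nat \<Rightarrow> int) \<Rightarrow> bool" where
  "state x y s \<longleftrightarrow> (\<forall>i j. i < j \<longrightarrow> j < b \<longrightarrow> s j < s i) \<and>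
     (\<forall>i<b. - int c \<le> s i \<and> ((s i, level x y (s i)) \<in> downs \<or> nw_cut \<le> level x y (s i) - s i))"

definition path_matrix :: "int \<Rightarrow> int \<Rightarrow> (nat \<Rightarrow> int) \<Rightarrow> nat \<Rightarrow> nat \<Rightarrow> real" where
  "path_matrix x y s i l = path_weight l (s i) (level x y (s i))"

text \<open>The invariant of the sweep. The power of \<open>1/2\<close> is the weight of all wall edges ahead as
  if none of them were visited; the visits are accounted for by the factors 2 in the path weights.\<close>

definition swept :: "(triangle set \<Rightarrow> real) \<Rightarrow> int \<Rightarrow> int \<Rightarrow> bool" where
  "swept w x y \<longleftrightarrow> (\<forall>s. state x y s \<longrightarrow>
     tiling_sum w (region (rem_ups x y) (rem_downs x y (s ` {..<b}))) =
       (1 / 2) ^ card (rem_ups x y \<inter> wall) * det_of b (path_matrix x y s))"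

lemma sweptD:
  "swept w x y \<Longrightarrow> state x y s \<Longrightarrow>
     tiling_sum w (region (rem_ups x y) (rem_downs x y (s ` {..<b}))) =
       (1 / 2) ^ card (rem_ups x y \<inter> wall) * det_of b (path_matrix x y s)"
  by (simp add: swept_def)

lemma finite_rem: "finite (rem_ups x y)" "finite (rem_downs x y S)"
  by (rule finite_subset[OF _ finite_ups], auto simp: rem_ups_def)
    (rule finite_subset[OF _ finite_downs], auto simp: rem_downs_def)

lemma rem_ups_next: "rem_ups (x + 1) y = rem_ups x y - {(x, y)}"
proof (rule Set.set_eqI)
  fix p :: lattice_point
  obtain u v where p: "p = (u, v)" by (cases p)
  have "x + 1 \<le> u \<longleftrightarrow> x \<le> u \<and> u \<noteq> x" by linarith
  then show "p \<in> rem_ups (x + 1) y \<longleftrightarrow> p \<in> rem_ups x y - {(x, y)}"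
    unfolding p by (cases "u = x") (simp_all add: rem_ups_def, blast)
qed

lemma rem_downs_next:
  assumes "x \<notin> S"
  shows "rem_downs (x + 1) y S = rem_downs x y S - {(x, y)}"
proof (rule Set.set_eqI)
  fix p :: lattice_point
  obtain u v where p: "p = (u, v)" by (cases p)
  have "x + 1 \<le> u \<longleftrightarrow> x \<le> u \<and> u \<noteq> x" by linarith
  then show "p \<in> rem_downs (x + 1) y S \<longleftrightarrow> p \<in> rem_downs x y S - {(x, y)}"
    unfolding p using assms by (cases "u = x") (simp_all add: rem_downs_def, auto)
qed

lemma card_wall_next:
  assumes "(x, y) \<in> ups"
  shows "(1 / 2 :: real) ^ card (rem_ups x y \<inter> wall) =
    (if (x, y) \<in> wall then 1 / 2 else 1) * (1 / 2) ^ card (rem_ups (x + 1) y \<inter> wall)"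
proof -
  have "(x, y) \<in> rem_ups x y" using assms by (simp add: rem_ups_def)
  moreover have "rem_ups (x + 1) y \<inter> wall = rem_ups x y \<inter> wall - {(x, y)}"
    by (auto simp: rem_ups_next)
  ultimately show ?thesis
    using finite_rem(1)[of x y] card_Suc_Diff1[of "rem_ups x y \<inter> wall" "(x, y)"]
    by (auto simp flip: power_Suc)
qed

lemma state_next_free:
  assumes "state x y s" "x \<notin> s ` {..<b}"
  shows "state (x + 1) y s" "\<And>i l. i < b \<Longrightarrow> path_matrix (x + 1) y s i l = path_matrix x y s i l"
proof -
  have "level (x + 1) y (s i) = level x y (s i)" if "i < b" for i
    using assms(2) that by (auto simp: level_def)
  then show "state (x + 1) y s" "\<And>i l. i < b \<Longrightarrow> path_matrix (x + 1) y s i l = path_matrix x y s i l"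
    using assms(1) by (auto simp: state_def path_matrix_def)
qed

text \<open>If no path is at \<open>(x, y)\<close>, then the down triangle below this edge can only be covered
  together with the up triangle above it. If that one is missing, then \<open>(x, y)\<close> is an endpoint
  that no path reaches: the region has no tiling, and the column of this endpoint is zero.\<close>

lemma sweep_free:
  assumes sw: "swept w (x + 1) y" and st: "state x y s" and x: "x \<notin> s ` {..<b}"
    and xc: "- int c \<le> x" and y: "0 \<le> y" "y < int a + int c"
    and wv: "\<And>x y. (x, y) \<in> ups \<Longrightarrow> w {up (x, y), down (x, y)} = (if (x, y) \<in> wall then 1 / 2 else 1)"
  shows "tiling_sum w (region (rem_ups x y) (rem_downs x y (s ` {..<b}))) =
    (1 / 2) ^ card (rem_ups x y \<inter> wall) * det_of b (path_matrix x y s)"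
proof -
  let ?S = "s ` {..<b}"
  have next_eq: "tiling_sum w (region (rem_ups (x + 1) y) (rem_downs (x + 1) y ?S)) =
      (1 / 2) ^ card (rem_ups (x + 1) y \<inter> wall) * det_of b (path_matrix x y s)"
    using sw state_next_free[OF st x] det_of_cong[of b "path_matrix (x + 1) y s" "path_matrix x y s"]
    by (auto simp: swept_def)
  have downs_next: "rem_downs (x + 1) y ?S = rem_downs x y ?S - {(x, y)}"
    using x by (rule rem_downs_next)
  show ?thesis
  proof (cases "(x, y) \<in> downs")
    case False
    then have "(x, y) \<notin> ups" by (auto simp: ups_def downs_def)
    then have "(x, y) \<notin> rem_ups x y" "(x, y) \<notin> rem_downs x y ?S"
      using False by (simp_all add: rem_ups_def rem_downs_def)
    then have "rem_ups (x + 1) y = rem_ups x y" "rem_downs (x + 1) y ?S = rem_downs x y ?S"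
      by (simp_all add: rem_ups_next downs_next)
    then show ?thesis using next_eq by simp
  next
    case down: True
    then have q: "(x, y) \<in> rem_downs x y ?S" using x by (simp add: rem_downs_def)
    show ?thesis
    proof (cases "(x, y) \<in> ups")
      case True
      have "{p \<in> rem_ups x y. (x, y) \<in> mates p} = {(x, y)}"
        using True by (auto simp: rem_ups_def mem_mates)
      then have "tiling_sum w (region (rem_ups x y) (rem_downs x y ?S)) =
          w {up (x, y), down (x, y)} * tiling_sum w (region (rem_ups (x + 1) y) (rem_downs (x + 1) y ?S))"
        using tiling_sum_region_down[OF finite_rem q, of w] by (simp add: rem_ups_next downs_next)
      then show ?thesis using next_eq True by (simp add: wv card_wall_next)
    next
      case False
      have "{p \<in> rem_ups x y. (x, y) \<in> mates p} = {}"
        using False by (auto simp: rem_ups_def mem_mates)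
      then have "tiling_sum w (region (rem_ups x y) (rem_downs x y ?S)) = 0"
        using tiling_sum_region_down[OF finite_rem(1)[of x y] finite_rem(2) q, of w] by (simp only: sum.empty)
      moreover have "det_of b (path_matrix x y s) = 0"
      proof -
        have xy: "y - x = nw_cut" using down False y by (auto simp: ups_def downs_def)
        define l where "l = nat (int b - int c - 1 - x)"
        have xl: "x = end_x l" "y = end_y l" "l < b"
          using down xy xc by (auto simp: l_def end_x_def end_y_def downs_def nw_cut_def)
        have "path_matrix x y s i l = 0" if i: "i < b" for i
        proof (cases "s i < x")
          case True
          then show ?thesis using xy xl by (simp add: path_matrix_def level_def path_weight_def)
        next
          case False
          then have gt: "x < s i" using x i by force
          then have lev: "level x y (s i) = y" by (simp add: level_def)
          then have "(s i, y) \<in> downs" using st i gt xy by (auto simp: state_def)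
          then show ?thesis using path_weight_beside_end[of l "s i"] gt lev xl by (simp add: path_matrix_def)
        qed
        then show ?thesis using det_of_zero_col[OF xl(3)] by blast
      qed
      ultimately show ?thesis by simp
    qed
  qed
qed

lemma state_after_cut:
  assumes "state x y s" "k < b" "s k = x" "(x, y) \<notin> ups" "y < int a + int c"
  shows "nw_cut \<le> y - x"
  using assms by (auto simp: state_def level_def downs_def ups_def)

text \<open>A path that has ended is carried along without covering any triangle.\<close>

lemma sweep_past_cut:
  assumes sw: "swept w (x + 1) y" and st: "state x y s" and k: "k < b" "s k = x"
    and notup: "(x, y) \<notin> ups" and y: "y < int a + int c"
  shows "tiling_sum w (region (rem_ups x y) (rem_downs x y (s ` {..<b}))) =
    (1 / 2) ^ card (rem_ups x y \<inter> wall) * det_of b (path_matrix x y s)"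
proof -
  have cut: "nw_cut \<le> y - x" using state_after_cut[OF st k notup y] .
  have lev: "level (x + 1) y (s i) = (if s i = x then y + 1 else level x y (s i))" for i
    by (auto simp: level_def)
  have "state (x + 1) y s"
    using st cut by (auto simp: state_def lev level_def)
  moreover have "path_matrix (x + 1) y s = path_matrix x y s"
    using cut by (intro ext) (auto simp: path_matrix_def lev level_def path_weight_after_cut)
  moreover have "(x, y) \<notin> rem_ups x y" using notup by (simp add: rem_ups_def)
  then have "rem_ups (x + 1) y = rem_ups x y" by (simp add: rem_ups_next)
  moreover have "rem_downs (x + 1) y (s ` {..<b}) = rem_downs x y (s ` {..<b})"
  proof (rule Set.set_eqI)
    fix p :: lattice_point
    obtain u v where p: "p = (u, v)" by (cases p)
    have "x + 1 \<le> u \<longleftrightarrow> x \<le> u \<and> u \<noteq> x" by linarith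
    moreover have "x \<in> s ` {..<b}" using k by blast
    moreover have "(x, y + 1) \<notin> downs" using cut by (simp add: downs_def)
    ultimately show "p \<in> rem_downs (x + 1) y (s ` {..<b}) \<longleftrightarrow> p \<in> rem_downs x y (s ` {..<b})"
      unfolding p rem_downs_def by (cases "u = x"; cases "v = y + 1") simp_all
  qed
  ultimately show ?thesis using sw by (auto simp: swept_def)
qed

lemma path_matrix_row:
  assumes "\<And>j. j \<noteq> k \<Longrightarrow> j < b \<Longrightarrow> s j \<noteq> x" "k < b" "s k = x"
  shows "det_of b (path_matrix (x + 1) y (s(k := z))) =
    det_of b ((path_matrix x y s)(k := (\<lambda>l. path_weight l z (level (x + 1) y z))))"
proof (rule det_of_cong)
  fix i l assume "i < b" "l < b"
  then show "path_matrix (x + 1) y (s(k := z)) i l =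
      ((path_matrix x y s)(k := (\<lambda>l. path_weight l z (level (x + 1) y z)))) i l"
    using assms level_next[of "s i" x y] by (cases "i = k") (simp_all add: path_matrix_def)
qed

text \<open>The path at \<open>(x, y)\<close> steps to \<open>(x, y + 1)\<close> or to
  \<open>(x - 1, y + 1)\<close>. Row \<open>k\<close> of the matrix is the corresponding combination of two
  rows. If \<open>(x - 1, y + 1)\<close> is already occupied, then the second step is impossible, and the
  second determinant vanishes because two of its rows agree.\<close>

lemma sweep_occupied:
  assumes sw: "swept w (x + 1) y" and st: "state x y s" and k: "k < b" "s k = x"
    and xy: "(x, y) \<in> ups"
    and wf: "(x, y + 1) \<in> downs \<Longrightarrow> w {up (x, y), down (x, y + 1)} = (if y - x = nw_cut - 1 then 1 / 2 else 1)"
    and wg: "(x - 1, y + 1) \<in> downs \<Longrightarrow> w {up (x, y), down (x - 1, y + 1)} = 1"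
  shows "tiling_sum w (region (rem_ups x y) (rem_downs x y (s ` {..<b}))) =
    (1 / 2) ^ card (rem_ups x y \<inter> wall) * det_of b (path_matrix x y s)"
proof -
  define S where "S = s ` {..<b}"
  define R where "R z = region (rem_ups (x + 1) y) (rem_downs x y S - {(z, y + 1)})" for z
  define M where "M = path_matrix x y s"
  define d where "d z = det_of b (M(k := (\<lambda>l. path_weight l z (y + 1))))" for z
  define \<kappa> :: real where "\<kappa> = (1 / 2) ^ card (rem_ups (x + 1) y \<inter> wall)"
  define cf :: real where "cf = (if (x, y + 1) \<in> downs then (if y - x = nw_cut - 1 then 1 / 2 else 1) else 0)"
  define cg :: real where "cg = (if (x - 1, y + 1) \<in> downs then 1 else 0)"
  define \<gamma> :: real where "\<gamma> = (if (x, y) \<in> wall then 2 else 1)"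
  have xS: "x \<in> S" using k by (auto simp: S_def)
  have dec: "s j < s i" if "i < j" "j < b" for i j using st that by (simp add: state_def)
  have other: "s j \<noteq> x" if "j \<noteq> k" "j < b" for j
    using dec[of j k] dec[of k j] that k by (cases "j < k") auto
  have Dx: "(x, y) \<notin> rem_downs x y S" using xS by (simp add: rem_downs_def)
  have f_iff: "(x, y + 1) \<in> rem_downs x y S \<longleftrightarrow> (x, y + 1) \<in> downs"
    by (simp add: rem_downs_def)
  have g_iff: "(x - 1, y + 1) \<in> rem_downs x y S \<longleftrightarrow> (x - 1, y + 1) \<in> downs \<and> x - 1 \<notin> S"
    by (simp add: rem_downs_def)
  have f_term: "tiling_sum w (R x) = \<kappa> * d x" if "(x, y + 1) \<in> downs"
  proof -
    have "- int c \<le> s i \<and> ((s i, level (x + 1) y (s i)) \<in> downs \<or> nw_cut \<le> level (x + 1) y (s i) - s i)"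
      if "i < b" for i
    proof (cases "s i = x")
      case True
      then show ?thesis using \<open>(x, y + 1) \<in> downs\<close> by (simp add: level_def) (simp add: downs_def)
    next
      case False
      then show ?thesis using st that by (simp add: state_def level_next)
    qed
    then have "state (x + 1) y s" using dec by (simp add: state_def)
    moreover have "rem_downs (x + 1) y S = rem_downs x y S - {(x, y + 1)}"
    proof (rule Set.set_eqI)
      fix p :: lattice_point
      obtain u v where p: "p = (u, v)" by (cases p)
      have "x + 1 \<le> u \<longleftrightarrow> x \<le> u \<and> u \<noteq> x" by linarith
      then show "p \<in> rem_downs (x + 1) y S \<longleftrightarrow> p \<in> rem_downs x y S - {(x, y + 1)}"
        unfolding p rem_downs_def using xS by (cases "u = x"; cases "v = y + 1") simp_all
    qed
    moreover have "det_of b (path_matrix (x + 1) y s) = d x"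
      using path_matrix_row[of k s x y x] other k by (simp add: d_def M_def level_def fun_upd_idem)
    ultimately show ?thesis using sweptD[OF sw, of s] by (simp add: R_def S_def \<kappa>_def)
  qed
  have g_term: "tiling_sum w (R (x - 1)) = \<kappa> * d (x - 1)" if g: "(x - 1, y + 1) \<in> downs" "x - 1 \<notin> S"
  proof -
    let ?s = "s(k := x - 1)"
    have notg: "s j \<noteq> x - 1" if "j < b" for j using g(2) that by (metis S_def imageI lessThan_iff)
    have img: "?s ` {..<b} = insert (x - 1) (S - {x})"
      using k other unfolding S_def by (auto simp: image_iff)
    have "?s j < ?s i" if "i < j" "j < b" for i j
      using dec[OF that] notg[of j] that k by auto
    moreover have "- int c \<le> ?s i \<and> ((?s i, level (x + 1) y (?s i)) \<in> downs \<or> nw_cut \<le> level (x + 1) y (?s i) - ?s i)"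
      if "i < b" for i
    proof (cases "i = k")
      case True
      then show ?thesis using g by (simp add: level_def) (simp add: downs_def)
    next
      case False
      then have "level (x + 1) y (s i) = level x y (s i)" using other[of i] that by (simp add: level_next)
      then show ?thesis using st that False by (simp add: state_def)
    qed
    ultimately have "state (x + 1) y ?s" by (auto simp: state_def)
    moreover have "rem_downs (x + 1) y (?s ` {..<b}) = rem_downs x y S - {(x - 1, y + 1)}"
      unfolding img
    proof (rule Set.set_eqI)
      fix p :: lattice_point
      obtain u v where p: "p = (u, v)" by (cases p)
      have "x + 1 \<le> u \<longleftrightarrow> x \<le> u \<and> u \<noteq> x" by linarith
      then show "p \<in> rem_downs (x + 1) y (insert (x - 1) (S - {x})) \<longleftrightarrow> p \<in> rem_downs x y S - {(x - 1, y + 1)}"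
        unfolding p rem_downs_def using xS by (cases "u = x"; cases "v = y + 1"; cases "u = x - 1") simp_all
    qed
    moreover have "det_of b (path_matrix (x + 1) y ?s) = d (x - 1)"
      using path_matrix_row[of k s x y "x - 1"] other k by (simp add: d_def M_def level_def)
    ultimately show ?thesis using sweptD[OF sw, of ?s] by (simp add: R_def \<kappa>_def)
  qed
  have g_collide: "d (x - 1) = 0" if "x - 1 \<in> S"
  proof -
    obtain j where "j \<in> {..<b}" "x - 1 = s j" using \<open>x - 1 \<in> S\<close> unfolding S_def by (rule imageE)
    then have j: "j < b" "s j = x - 1" by simp_all
    then have "j \<noteq> k" using k by auto
    then show ?thesis
      unfolding d_def using j k by (intro det_of_equal_rows[of j b k]) (auto simp: M_def path_matrix_def level_def)
  qed
  have "\<gamma> * (cf * d x + cg * d (x - 1)) = det_of b M"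
  proof -
    have "det_of b M = det_of b (M(k := (\<lambda>l. (\<gamma> * cf) * path_weight l x (y + 1) + (\<gamma> * cg) * path_weight l (x - 1) (y + 1))))"
    proof (rule det_of_cong)
      fix i l assume "i < b" "l < b"
      then show "M i l = (M(k := (\<lambda>l. (\<gamma> * cf) * path_weight l x (y + 1) + (\<gamma> * cg) * path_weight l (x - 1) (y + 1)))) i l"
        using path_weight_step[OF xy, of l] k
        by (auto simp: M_def path_matrix_def level_def cf_def cg_def \<gamma>_def)
    qed
    then show ?thesis unfolding det_of_row_linear[OF k(1)] d_def by (simp add: algebra_simps)
  qed
  then have det_M: "cf * d x + cg * d (x - 1) = det_of b M / \<gamma>" by (simp add: \<gamma>_def field_simps split: if_splits)
  have p: "(x, y) \<in> rem_ups x y" using xy by (simp add: rem_ups_def)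
  have mates: "rem_downs x y S \<inter> mates (x, y) = rem_downs x y S \<inter> {(x, y + 1), (x - 1, y + 1)}"
    using Dx by (auto simp: mates_def)
  have "tiling_sum w (region (rem_ups x y) (rem_downs x y S)) =
      (\<Sum>q\<in>rem_downs x y S \<inter> {(x, y + 1), (x - 1, y + 1)}. w {up (x, y), down q} *
        tiling_sum w (region (rem_ups (x + 1) y) (rem_downs x y S - {q})))"
    using tiling_sum_region_up[OF finite_rem(1) finite_rem(2)[of x y S] p, of w]
    unfolding mates rem_ups_next .
  also have "\<dots> = cf * (\<kappa> * d x) + cg * (\<kappa> * d (x - 1))"
    using f_term g_term g_collide wf wg
    by (auto simp: Int_insert_right f_iff g_iff cf_def cg_def R_def)
  also have "\<dots> = \<kappa> * (cf * d x + cg * d (x - 1))" by (simp add: algebra_simps)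
  finally show ?thesis
    using card_wall_next[OF xy] unfolding det_M
    by (simp add: S_def M_def \<kappa>_def \<gamma>_def split: if_splits)
qed

text \<open>The weights of the three kinds of lozenges over an up triangle: the vertical lozenge, and the steps
  \<open>f\<close> and \<open>g\<close> of a path.\<close>

definition cut_weights :: "(triangle set \<Rightarrow> real) \<Rightarrow> bool" where
  "cut_weights w \<longleftrightarrow> (\<forall>x y. (x, y) \<in> ups \<longrightarrow>
     w {up (x, y), down (x, y)} = (if (x, y) \<in> wall then 1 / 2 else 1) \<and>
     w {up (x, y), down (x, y + 1)} = (if y - x = nw_cut - 1 then 1 / 2 else 1) \<and>
     w {up (x, y), down (x - 1, y + 1)} = 1)"

lemma swept_step:
  assumes "cut_weights w" "swept w (x + 1) y" "- int c \<le> x" "0 \<le> y" "y < int a + int c"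
  shows "swept w x y"
  unfolding swept_def
proof (intro allI impI)
  fix s assume st: "state x y s"
  show "tiling_sum w (region (rem_ups x y) (rem_downs x y (s ` {..<b}))) =
    (1 / 2) ^ card (rem_ups x y \<inter> wall) * det_of b (path_matrix x y s)"
  proof (cases "x \<in> s ` {..<b}")
    case False
    then show ?thesis
      using assms by (intro sweep_free[OF assms(2) st]) (auto simp: cut_weights_def)
  next
    case True
    then obtain k where k: "k < b" "s k = x" by auto
    show ?thesis
    proof (cases "(x, y) \<in> ups")
      case True
      then show ?thesis
        using assms(1) by (intro sweep_occupied[OF assms(2) st k]) (auto simp: cut_weights_def)
    next
      case False
      then show ?thesis using assms by (intro sweep_past_cut[OF assms(2) st k])
    qed
  qed
qed

lemma swept_row:
  assumes sw: "swept w (- int c) (y + 1)" and y: "0 \<le> y" "y < int a + int c"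
  shows "swept w (int b) y"
  unfolding swept_def
proof (intro allI impI)
  fix s assume st: "state (int b) y s"
  have lt: "s i < int b" if "i < b" for i
  proof -
    have "level (int b) y (s i) \<le> int a + int c" using y by (simp add: level_def)
    moreover have "(s i, level (int b) y (s i)) \<in> downs \<or> nw_cut \<le> level (int b) y (s i) - s i"
      using st that by (simp add: state_def)
    ultimately show ?thesis using ba ac by (auto simp: downs_def nw_cut_def)
  qed
  have ge: "- int c \<le> s i" if "i < b" for i using st that by (simp add: state_def)
  have lev: "level (- int c) (y + 1) (s i) = level (int b) y (s i)" if "i < b" for i
    using lt[OF that] ge[OF that] by (simp add: level_def)
  have "state (- int c) (y + 1) s" using st by (simp add: state_def lev)
  moreover have "rem_ups (- int c) (y + 1) = rem_ups (int b) y"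
    by (auto simp: rem_ups_def ups_def)
  moreover have "rem_downs (- int c) (y + 1) (s ` {..<b}) = rem_downs (int b) y (s ` {..<b})"
    using y by (auto simp: rem_downs_def downs_def)
  moreover have "det_of b (path_matrix (- int c) (y + 1) s) = det_of b (path_matrix (int b) y s)"
    by (rule det_of_cong) (simp add: path_matrix_def lev)
  ultimately show "tiling_sum w (region (rem_ups (int b) y) (rem_downs (int b) y (s ` {..<b}))) =
    (1 / 2) ^ card (rem_ups (int b) y \<inter> wall) * det_of b (path_matrix (int b) y s)"
    using sweptD[OF sw, of s] by simp
qed

text \<open>In the end every path sits at an endpoint; since there are as many paths as endpoints, the matrix is
  the identity.\<close>

lemma swept_top: "swept w (- int c) (int a + int c)"
  unfolding swept_def
proof (intro allI impI)
  let ?y = "int a + int c"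
  fix s assume st: "state (- int c) ?y s"
  have ge: "- int c \<le> s i" if "i < b" for i using st that by (simp add: state_def)
  have lev: "level (- int c) ?y (s i) = ?y" if "i < b" for i using ge[OF that] by (simp add: level_def)
  have dec: "s j + (int j - int i) \<le> s i" if "i \<le> j" "j < b" for i j
    using that
  proof (induction rule: dec_induct)
    case (step n)
    then have "s (Suc n) < s n" using st by (simp add: state_def)
    then show ?case using step by simp
  qed simp
  have "s 0 \<le> int b - int c - 1" using st pos lev[of 0] by (auto simp: state_def downs_def nw_cut_def)
  then have s_eq: "s i = end_x i" if i: "i < b" for i
  proof -
    have "int (b - 1) = int b - 1" "i \<le> b - 1" "b - 1 < b" using i pos by auto
    then show ?thesis
      using dec[of 0 i] dec[of i "b - 1"] ge[of "b - 1"] i \<open>s 0 \<le> int b - int c - 1\<close>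
      by (simp add: end_x_def)
  qed
  have "rem_ups (- int c) ?y = {}" by (auto simp: rem_ups_def ups_def)
  moreover have "rem_downs (- int c) ?y (s ` {..<b}) = {}"
  proof -
    have "x \<in> s ` {..<b}" if "(x, ?y) \<in> downs" for x
    proof
      show "nat (int b - int c - 1 - x) \<in> {..<b}" using that by (auto simp: downs_def)
      then show "x = s (nat (int b - int c - 1 - x))" using that by (simp add: s_eq end_x_def downs_def)
    qed
    then show ?thesis by (auto simp: rem_downs_def downs_def)
  qed
  moreover have "det_of b (path_matrix (- int c) ?y s) = 1"
  proof -
    have "path_matrix (- int c) ?y s i l = of_bool (i = l)" if "i < b" for i l
    proof -
      have "path_matrix (- int c) ?y s i l = path_weight l (end_x i) ?y"
        using lev[OF that] s_eq[OF that] by (simp add: path_matrix_def)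
      then show ?thesis by (simp add: path_weight_def end_x_def nw_cut_def)
    qed
    then show ?thesis by (intro det_of_unitriangular) auto
  qed
  ultimately show "tiling_sum w (region (rem_ups (- int c) ?y) (rem_downs (- int c) ?y (s ` {..<b}))) =
    (1 / 2) ^ card (rem_ups (- int c) ?y \<inter> wall) * det_of b (path_matrix (- int c) ?y s)"
    by (simp add: region_def)
qed

lemma swept_start:
  assumes w: "cut_weights w"
  shows "swept w (- int c) 0"
proof -
  have row: "swept w (int b - int m) y"
    if "swept w (- int c) (y + 1)" "0 \<le> y" "y < int a + int c" "m \<le> b + c" for y m
    using that(4)
  proof (induction m)
    case 0
    show ?case using swept_row[OF that(1-3)] by simp
  next
    case (Suc m)
    have "int b - int (Suc m) + 1 = int b - int m" by simp
    then have "swept w (int b - int (Suc m) + 1) y" using Suc by simp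
    then show ?case by (rule swept_step[OF w]) (use that(2,3) Suc.prems in linarith)+
  qed
  have "swept w (- int c) (int a + int c - int n)" if "n \<le> a + c" for n
    using that
  proof (induction n)
    case (Suc n)
    have eq: "int a + int c - int (Suc n) + 1 = int a + int c - int n" "int b - int (b + c) = - int c"
      by simp_all
    have "swept w (- int c) (int a + int c - int (Suc n) + 1)" unfolding eq using Suc by simp
    from row[OF this, of "b + c"] show ?case unfolding eq using Suc.prems by simp
  qed (simp add: swept_top)
  from this[of "a + c"] show ?thesis by simp
qed

lemma card_wall: "card (ups \<inter> wall) = a"
proof -
  let ?f = "\<lambda>j. (int b - int j, 2 * int j - 1)"
  have "ups \<inter> wall = ?f ` {1..a}"
  proof (intro equalityI subsetI)
    fix p assume p: "p \<in> ups \<inter> wall"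
    obtain x y where xy: "p = (x, y)" by (cases p)
    have "p = ?f (nat (int b - x))" "nat (int b - x) \<in> {1..a}"
      using p unfolding xy by (auto simp: ups_def wall_def)
    then show "p \<in> ?f ` {1..a}" by blast
  next
    fix p assume "p \<in> ?f ` {1..a}"
    then show "p \<in> ups \<inter> wall" using ba ac by (auto simp: ups_def wall_def nw_cut_def)
  qed
  moreover have "inj_on ?f {1..a}" by (simp add: inj_on_def)
  ultimately show ?thesis by (simp add: card_image)
qed

lemma tiling_sum_det:
  assumes w: "cut_weights w"
  shows "tiling_sum w (region ups {(x, y) \<in> downs. 1 \<le> y}) = (1 / 2) ^ a *
    det_of b (\<lambda>j l. walk_weight (int a + int c - int l) (int c + int l - int j)
      + walk_weight (int a + int c - int l) (int c + int l + 1 + int j))"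
proof -
  define s where "s i = int b - 1 - int i" for i
  have lev: "level (- int c) 0 (s i) = 0" if "i < b" for i using that by (simp add: level_def s_def)
  have st: "state (- int c) 0 s"
    using ba ac unfolding state_def by (auto simp: lev) (auto simp: s_def downs_def nw_cut_def)
  have "rem_ups (- int c) 0 = ups" by (auto simp: rem_ups_def ups_def)
  moreover have "rem_downs (- int c) 0 (s ` {..<b}) = {(x, y) \<in> downs. 1 \<le> y}"
  proof -
    have "x \<in> s ` {..<b}" if "(x, 0) \<in> downs" for x
    proof
      show "nat (int b - 1 - x) \<in> {..<b}" using that by (auto simp: downs_def)
      then show "x = s (nat (int b - 1 - x))" using that by (simp add: s_def downs_def)
    qed
    then show ?thesis by (auto simp: rem_downs_def downs_def)
  qed
  moreover have "det_of b (path_matrix (- int c) 0 s) =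
      det_of b (\<lambda>j l. walk_weight (int a + int c - int l) (int c + int l - int j)
        + walk_weight (int a + int c - int l) (int c + int l + 1 + int j))"
  proof (rule det_of_cong)
    fix i l assume "i < b" "l < b"
    then have "- s i < nw_cut" using ba ac by (simp add: s_def nw_cut_def)
    then show "path_matrix (- int c) 0 s i l = walk_weight (int a + int c - int l) (int c + int l - int i)
        + walk_weight (int a + int c - int l) (int c + int l + 1 + int i)"
      using lev[OF \<open>i < b\<close>]
      by (simp add: path_matrix_def path_weight_def reflected_weight_def end_x_def end_y_def)
        (simp add: s_def algebra_simps)
  qed
  ultimately show ?thesis using sweptD[OF swept_start[OF w] st] by (simp add: card_wall)
qed

end

section \<open>The dented hexagon\<close>

lemma mem_hexagon_up:
  assumes "a > 0" "b > 0" "c > 0"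
  shows "up (x, y) \<in> hexagon a b c \<longleftrightarrow> 0 \<le> y \<and> y < int a + int c \<and> - int c \<le> x \<and> x < int b
    \<and> 0 \<le> x + y \<and> x + y < int a + int b"
proof -
  have "unit_triangle (up (x, y))" by (auto simp: unit_triangle_iff)
  moreover have "up (x, y) = {(x, y), (x + 1, y), (x, y + 1)}" by (simp add: up_def)
  ultimately show ?thesis by (auto simp: hexagon_def convex_hull_hexagon[OF assms])
qed

lemma mem_hexagon_down:
  assumes "a > 0" "b > 0" "c > 0"
  shows "down (x, y) \<in> hexagon a b c \<longleftrightarrow> 0 < y \<and> y \<le> int a + int c \<and> - int c \<le> x \<and> x < int b
    \<and> 0 \<le> x + y \<and> x + y < int a + int b"
proof -
  have "unit_triangle (down (x, y))" by (auto simp: unit_triangle_iff)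
  moreover have "down (x, y) = {(x, y), (x + 1, y), (x + 1, y - 1)}" by (simp add: down_def)
  ultimately show ?thesis by (auto simp: hexagon_def convex_hull_hexagon[OF assms])
qed

lemma region_of_unit_triangles:
  assumes "\<And>t. t \<in> R \<Longrightarrow> unit_triangle t"
  shows "R = region {p. up p \<in> R} {q. down q \<in> R}"
proof (rule Set.set_eqI)
  fix t
  show "t \<in> R \<longleftrightarrow> t \<in> region {p. up p \<in> R} {q. down q \<in> R}"
    using assms[of t] by (auto simp: region_def unit_triangle_iff)
qed

lemma nw_cell:
  "cell (nw_corner a b c) vec_e (- vec_f) i j =
    {up (i - 1 - int c, int a + int c - j), down (i - 1 - int c, int a + int c - j + 1)}"
  by (auto simp: cell_def nw_corner_def lattice_scale_def vec_e_def vec_f_def vec_g_def up_def down_def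
      algebra_simps)

lemma e_cell:
  "cell (e_corner a b c) (- vec_f) vec_g i j =
    {up (int b - j, int a - i + j), down (int b - j, int a - i + j)}"
  by (auto simp: cell_def e_corner_def lattice_scale_def vec_e_def vec_f_def vec_g_def up_def down_def
      algebra_simps)

lemma cell_subset_staircase:
  "1 \<le> i \<Longrightarrow> 1 \<le> j \<Longrightarrow> i + j \<le> int m \<Longrightarrow> cell V s t i j \<subseteq> staircase V s t m"
  unfolding staircase_def by (rule Union_upper) blast

lemma staircaseE:
  assumes "T \<in> staircase V s t m"
  obtains i j where "1 \<le> i" "1 \<le> j" "i + j \<le> int m" "T \<in> cell V s t i j"
  using assms unfolding staircase_def by blast

lemma up_in_nw_staircase:
  "up (x, y) \<in> staircase (nw_corner a b c) vec_e (- vec_f) m \<longleftrightarrow>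
    - int c \<le> x \<and> y < int a + int c \<and> int a + 2 * int c + 1 \<le> y - x + int m"
  (is "?l \<longleftrightarrow> ?r")
proof
  assume r: ?r
  have "up (x, y) \<in> cell (nw_corner a b c) vec_e (- vec_f) (x + int c + 1) (int a + int c - y)"
    unfolding nw_cell by simp
  then show ?l by (rule subsetD[OF cell_subset_staircase, rotated -1]) (use r in linarith)+
next
  assume ?l
  then show ?r by (rule staircaseE) (simp add: nw_cell)
qed

lemma down_in_nw_staircase:
  "down (x, y) \<in> staircase (nw_corner a b c) vec_e (- vec_f) m \<longleftrightarrow>
    - int c \<le> x \<and> y \<le> int a + int c \<and> int a + 2 * int c + 2 \<le> y - x + int m"
  (is "?l \<longleftrightarrow> ?r")
proof
  assume r: ?r
  have "down (x, y) \<in> cell (nw_corner a b c) vec_e (- vec_f) (x + int c + 1) (int a + int c - y + 1)"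
    unfolding nw_cell by simp
  then show ?l by (rule subsetD[OF cell_subset_staircase, rotated -1]) (use r in linarith)+
next
  assume ?l
  then show ?r by (rule staircaseE) (simp add: nw_cell)
qed

lemma in_e_staircase:
  "up (x, y) \<in> staircase (e_corner a b c) (- vec_f) vec_g m \<longleftrightarrow>
    x < int b \<and> x + y < int a + int b \<and> int a + 2 * int b \<le> 2 * x + y + int m"
  "down (x, y) \<in> staircase (e_corner a b c) (- vec_f) vec_g m \<longleftrightarrow>
    x < int b \<and> x + y < int a + int b \<and> int a + 2 * int b \<le> 2 * x + y + int m"
proof -
  let ?r = "x < int b \<and> x + y < int a + int b \<and> int a + 2 * int b \<le> 2 * x + y + int m"
  have "{up (x, y), down (x, y)} \<subseteq> staircase (e_corner a b c) (- vec_f) vec_g m" if r: ?r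
  proof -
    have "{up (x, y), down (x, y)} = cell (e_corner a b c) (- vec_f) vec_g (int a + int b - x - y) (int b - x)"
      unfolding e_cell by simp
    then show ?thesis by (simp only:) (rule cell_subset_staircase; use r in linarith)
  qed
  moreover have ?r if "up (x, y) \<in> staircase (e_corner a b c) (- vec_f) vec_g m"
    using that by (rule staircaseE) (simp add: e_cell)
  moreover have ?r if "down (x, y) \<in> staircase (e_corner a b c) (- vec_f) vec_g m"
    using that by (rule staircaseE) (simp add: e_cell)
  ultimately show "up (x, y) \<in> staircase (e_corner a b c) (- vec_f) vec_g m \<longleftrightarrow> ?r"
    "down (x, y) \<in> staircase (e_corner a b c) (- vec_f) vec_g m \<longleftrightarrow> ?r"
    by blast+
qed

lemma pair_in_marked:
  "{up (x, y), down q} \<in> marked (nw_corner a b c) vec_e (- vec_f) m \<longleftrightarrow>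
    q = (x, y + 1) \<and> - int c \<le> x \<and> y < int a + int c \<and> int a + 2 * int c = y - x + int m"
  (is "?l1 \<longleftrightarrow> ?r1")
  "{up (x, y), down q} \<in> marked (e_corner a b c) (- vec_f) vec_g m \<longleftrightarrow>
    q = (x, y) \<and> x < int b \<and> x + y < int a + int b \<and> int a + 2 * int b = 2 * x + y + int m + 1"
  (is "?l2 \<longleftrightarrow> ?r2")
proof -
  show "?l1 \<longleftrightarrow> ?r1"
  proof
    assume r: ?r1
    then have "{up (x, y), down q} = cell (nw_corner a b c) vec_e (- vec_f) (x + int c + 1) (int a + int c - y)"
      unfolding nw_cell by simp
    then show ?l1 unfolding marked_def using r
      by (intro CollectI exI[of _ "x + int c + 1"] exI[of _ "int a + int c - y"]) auto
  qed (auto simp: marked_def nw_cell doubleton_eq_iff)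
  show "?l2 \<longleftrightarrow> ?r2"
  proof
    assume r: ?r2
    then have "{up (x, y), down q} = cell (e_corner a b c) (- vec_f) vec_g (int a + int b - x - y) (int b - x)"
      unfolding e_cell by simp
    then show ?l2 unfolding marked_def using r
      by (intro CollectI exI[of _ "int a + int b - x - y"] exI[of _ "int b - x"]) auto
  qed (auto simp: marked_def e_cell doubleton_eq_iff)
qed

lemma weighted_tiling_count_eq_tiling_sum:
  assumes "a > 0" "b > 0" "c > 0"
  shows "weighted_tiling_count a b c =
    tiling_sum (\<lambda>l. if l \<in> marked_positions a b c then 1 / 2 else 1) (dented_hexagon a b c)"
  unfolding weighted_tiling_count_def tiling_sum_def
proof (intro sum.cong refl)
  fix T assume "T \<in> lozenge_tilings (dented_hexagon a b c)"
  then have "partition_on (dented_hexagon a b c) T" by (simp add: lozenge_tilings_def)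
  moreover have "finite (dented_hexagon a b c)"
    unfolding dented_hexagon_def using finite_hexagon[OF assms] by blast
  ultimately have "finite T" using finite_elements by metis
  then show "(1 / 2) ^ card (T \<inter> marked_positions a b c) =
      (\<Prod>l\<in>T. if l \<in> marked_positions a b c then 1 / 2 else 1 :: real)"
    by (simp add: prod.If_cases Int_def)
qed

context dented_sizes
begin

lemma dented_hexagon_region: "dented_hexagon a b c = region ups {(x, y) \<in> downs. 1 \<le> y}"
proof -
  have abc: "a > 0" "b > 0" "c > 0" and min: "min a b = b" "min a c = a" using pos ba ac by auto
  have "unit_triangle t" if "t \<in> dented_hexagon a b c" for t
    using that by (simp add: dented_hexagon_def hexagon_def)
  then have "dented_hexagon a b c =
      region {p. up p \<in> dented_hexagon a b c} {q. down q \<in> dented_hexagon a b c}"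
    by (rule region_of_unit_triangles)
  moreover have "up (x, y) \<in> dented_hexagon a b c \<longleftrightarrow> (x, y) \<in> ups" for x y
    unfolding dented_hexagon_def Diff_iff mem_hexagon_up[OF abc] min up_in_nw_staircase in_e_staircase
    by (auto simp: ups_def nw_cut_def)
  then have "{p. up p \<in> dented_hexagon a b c} = ups" by auto
  moreover have "down (x, y) \<in> dented_hexagon a b c \<longleftrightarrow> (x, y) \<in> downs \<and> 1 \<le> y" for x y
    unfolding dented_hexagon_def Diff_iff mem_hexagon_down[OF abc] min down_in_nw_staircase in_e_staircase
    by (auto simp: downs_def nw_cut_def)
  then have "{q. down q \<in> dented_hexagon a b c} = {(x, y) \<in> downs. 1 \<le> y}" by auto
  ultimately show ?thesis by simp
qed

lemma cut_weights_marked: "cut_weights (\<lambda>l. if l \<in> marked_positions a b c then 1 / 2 else 1)"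
proof -
  have min: "min a b = b" "min a c = a" using ba ac by auto
  show ?thesis
    unfolding cut_weights_def marked_positions_def Un_iff min pair_in_marked
    by (auto simp: ups_def wall_def nw_cut_def)
qed

end

theorem theorem1p2:
  fixes a b c :: nat
  assumes "a > 0" and "b > 0" and "c > 0" and "b \<le> a" and "a \<le> c"
  shows "weighted_tiling_count a b c =
    2 powi (- int a - int b) *
    (\<Prod>j = 1..b.
       fact (j - 1) * fact (a + c - b + 2 * j - 1)
         * pochhammer (real (c - a + 3 * j - 1)) (b - j)
         * pochhammer (real (a + 2 * c + 3 * j - 1)) (b - j + 1)
       / (fact (b + c + j - 1) * fact (a - b + 2 * j - 1)))"
proof -
  interpret dented_sizes a b c by unfold_locales (use assms in auto)
  have "weighted_tiling_count a b c = (1 / 2) ^ a *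
      det_of b (\<lambda>j l. walk_weight (int a + int c - int l) (int c + int l - int j)
        + walk_weight (int a + int c - int l) (int c + int l + 1 + int j))"
    unfolding weighted_tiling_count_eq_tiling_sum[OF assms(1-3)] dented_hexagon_region
    by (rule tiling_sum_det[OF cut_weights_marked])
  moreover have "2 powi (- int a - int b) = (1 / 2 :: real) ^ a * (1 / 2) ^ b"
  proof -
    have "- int a - int b = - int (a + b)" by simp
    then have "2 powi (- int a - int b) = inverse ((2 :: real) ^ (a + b))"
      by (simp only: power_int_minus power_int_of_nat)
    then show ?thesis by (simp add: power_add power_divide inverse_eq_divide)
  qed
  ultimately show ?thesis
    unfolding det_reflected_walks[OF assms(4,5)] shifted_det_value_nat[OF assms(4,5)]
    by (simp add: mult.assoc)
qed

end
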